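(* Let $\mathbf{P}$ be a fixed pattern matrix, let $\mathbf{B}=\mathbf{B}_{m\times n}$ be the $m\times n$ blown up matrix of $\mathbf{P}$ with positive singular values $s_1\ge\dots\ge s_r>0$ ($r=\operatorname{rank}\mathbf{B}=\operatorname{rank}\mathbf{P}$), let $\mathbf{W}=\mathbf{W}_{m\times n}$ be a Wigner-noise, and let $\mathbf{A}=\mathbf{B}+\mathbf{W}$. Then, under the growth condition GC1, the matrix $\mathbf{A}$ almost surely has $r$ singular values $z_1,\dots,z_r$ such that $$|z_i-s_i|=\mathcal{O}(\sqrt{m+n}),\qquad i=1,\dots,r,$$ and for the other singular values of $\mathbf{A}$, almost surely, $$z_j=\mathcal{O}(\sqrt{m+n}),\qquad j=r+1,\dots,\min\{m,n\}.$$
   Context: Wigner-noise: an $m\times n$ real random matrix $\mathbf{W}$ with independent entries $w_{ij}$, $\mathbb{E}(w_{ij})=0$, uniformly bounded: $|w_{ij}|\le K$ for all $i,j$, with a constant $K>0$ independent of $m$ and $n$. Blown up matrix: given an $a\times b$ pattern matrix $\mathbf{P}$ with entries $0\le p_{ij}\le1$ and positive integers $m_1,\dots,m_a$ with $\sum_i m_i=m$ and $n_1,\dots,n_b$ with $\sum_j n_j=n$, the blown up matrix $\mathbf{B}$ is the $m\times n$ matrix divided into $a\times b$ blocks, where block $(i,j)$ is an $m_i\times n_j$ matrix with all entries equal to $p_{ij}$. The pattern $\mathbf{P}$ (with $a,b$) is fixed, while $m,n$ and the block sizes vary. GC1: there are constants $0<c<1$ and $0<d<1$, independent of $m,n$,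 such that $m_i/m\ge c$ for $i=1,\dots,a$ and $n_j/n\ge d$ for $j=1,\dots,b$. Almost surely: a property $\mathcal{P}_{m,n}$ holds almost surely for the random matrices $\mathbf{A}_{m\times n}$ if $\mathbb{P}(\exists\, m_0,n_0\in\mathbb{N}$ such that for all $m\ge m_0$ and $n\ge n_0$, $\mathbf{A}_{m\times n}$ has $\mathcal{P}_{m,n})=1$, where $m,n$ and the block sizes grow subject to the stated growth condition and $K$ is kept fixed. A bound $\mathcal{O}(f(m,n))$ holds almost surely if there is a constant $C$ independent of $m,n$ such that the bound $\le C f(m,n)$ holds almost surely in this sense. *)

theory Defs
  imports "HOL-Probability.Probability" "Jordan_Normal_Form.DL_Rank" "Jordan_Normal_Form.Char_Poly"
begin

text \<open>The \<^term>\<open>min m n\<close> singular values of an \<open>m \<times> n\<close> matrix in non-increasing order, repeated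
  according to multiplicity: the square roots of the largest \<^term>\<open>min m n\<close> eigenvalues of \<open>A\<^sup>T A\<close>.
  All \<open>n\<close> roots of its characteristic polynomial are real and nonnegative, and if \<open>n > m\<close>,
  then at least \<open>n - m\<close> of them vanish; \<open>take\<close> drops exactly \<open>n - m\<close> zeros in this case.\<close>

definition singular_values :: "real mat \<Rightarrow> real list" where
  "singular_values A =
     take (min (dim_row A) (dim_col A))
       (rev (sorted_list_of_multiset (image_mset sqrt (proots (char_poly (transpose_mat A * A))))))"

definition block_sizes :: "nat \<Rightarrow> nat \<Rightarrow> (nat \<Rightarrow> nat) \<Rightarrow> bool" where
  "block_sizes a m \<mu> \<longleftrightarrow> (\<forall>i<a. 0 < \<mu> i) \<and> (\<Sum>i<a. \<mu> i) = m"

text \<open>Rows, columns and blocks are numbered from 0. Block \<open>i\<close> consists of the indices \<open>k\<close> with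
  \<open>\<mu> 0 + \<dots> + \<mu> (i - 1) \<le> k < \<mu> 0 + \<dots> + \<mu> i\<close>.\<close>

definition block_of :: "(nat \<Rightarrow> nat) \<Rightarrow> nat \<Rightarrow> nat" where
  "block_of \<mu> k = (LEAST i. k < (\<Sum>t\<le>i. \<mu> t))"

definition blown_up :: "real mat \<Rightarrow> (nat \<Rightarrow> nat) \<Rightarrow> (nat \<Rightarrow> nat) \<Rightarrow> real mat" where
  "blown_up P \<mu> \<nu> =
     Matrix.mat (\<Sum>i<dim_row P. \<mu> i) (\<Sum>j<dim_col P. \<nu> j)
       (\<lambda>(k, l). P $$ (block_of \<mu> k, block_of \<nu> l))"

definition GC1 :: "real \<Rightarrow> real \<Rightarrow> nat \<Rightarrow> nat \<Rightarrow> nat \<Rightarrow> nat \<Rightarrow> (nat \<Rightarrow> nat) \<Rightarrow> (nat \<Rightarrow> nat) \<Rightarrow> bool" where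
  "GC1 c d a b m n \<mu> \<nu> \<longleftrightarrow>
     (\<forall>i<a. real (\<mu> i) / real m \<ge> c) \<and> (\<forall>j<b. real (\<nu> j) / real n \<ge> d)"

text \<open>The bound on the entries is only required outside a null set, as usual for random variables.\<close>

definition wigner_noise :: "'w measure \<Rightarrow> real \<Rightarrow> nat \<Rightarrow> nat \<Rightarrow> ('w \<Rightarrow> real mat) \<Rightarrow> bool" where
  "wigner_noise M K m n W \<longleftrightarrow>
     (\<forall>\<omega>\<in>space M. W \<omega> \<in> carrier_mat m n) \<and>
     prob_space.indep_vars M (\<lambda>_. borel) (\<lambda>(i, j) \<omega>. W \<omega> $$ (i, j)) ({..<m} \<times> {..<n}) \<and>
     (\<forall>i<m. \<forall>j<n. prob_space.expectation M (\<lambda>\<omega>. W \<omega> $$ (i, j)) = 0 \<and>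
        (AE \<omega> in M. \<bar>W \<omega> $$ (i, j)\<bar> \<le> K))"

text \<open>A property \<open>Q m n\<close> of the random objects with index \<open>(m, n)\<close> holds almost surely if, with
  probability one, it holds for all \<open>m\<close> and \<open>n\<close> beyond (random) thresholds.\<close>

definition almost_surely :: "'w measure \<Rightarrow> (nat \<Rightarrow> nat \<Rightarrow> 'w \<Rightarrow> bool) \<Rightarrow> bool" where
  "almost_surely M Q \<longleftrightarrow> (AE \<omega> in M. \<exists>m0 n0. \<forall>m\<ge>m0. \<forall>n\<ge>n0. Q m n \<omega>)"

end

(* Weyl's perturbation bound |z_i - s_i| <= ||W|| for singular values reduces the theorem to showing
   ||W|| <= 16 K sqrt (m + n) for all large m and n, almost surely. The operator norm is at most
   twice the maximum of the bilinear form of W over the lattice points with spacing 1/(4 sqrt m) and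
   1/(4 sqrt n) in the unit balls. There are at most (3 * 2^16)^(m + n) pairs of such points; for each pair
   Hoeffding's inequality bounds the probability of exceeding 8 K sqrt (m + n) by exp (-32 (m + n)),
   and the Borel-Cantelli lemma applies to the unions over m + n = k. *)

theory Submission
  imports Defs "Jordan_Normal_Form.Schur_Decomposition" "Jordan_Normal_Form.Spectral_Radius"
begin

unbundle no inner_syntax
unbundle no vec_syntax

section \<open>Spectral theorem for real symmetric matrices\<close>

text \<open>The noise matrices of all sizes live on one probability space with an unspecified joint
  law, so a common exceptional null set can only come from summable probabilities, that is, from the
  convergence half of Borel-Cantelli. The constants serve this: the threshold
  \<open>8 K sqrt (m + n)\<close> gives the rate 8^2 / 2 = 32, and
  \<open>exp (-32) \<le> 2^(-32)\<close> beats the factor \<open>3 * 2^16\<close> per coordinate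
  from the lattice count with so much room that the number of pairs with a given sum is absorbed as
  well. The integer lattice stands in for an abstract epsilon-net: rounding towards zero never
  leaves the ball, and integrality allows counting without volumes. Singular values are defined by
  the characteristic polynomial of \<open>A\<^sup>T * A\<close>, whereas the noise is controlled
  through norms of vectors. The link is an orthogonal \<open>U\<close> for which the columns of
  \<open>A * U\<close> are orthogonal; both the min-max argument and the rank are read off from it.
  The rank enters because the bound on the remaining singular values of the sum rests on those of
  the blown up matrix being exactly 0 beyond the rank of the pattern.\<close>

lemma symmetric_real_eigenvalue:
  fixes A :: "real mat"
  assumes A: "A \<in> carrier_mat n n" and sym: "A\<^sup>T = A" and n: "0 < n"
  shows "\<exists>k. eigenvalue A k"
proof -
  let ?C = "map_mat complex_of_real A"
  have C: "?C \<in> carrier_mat n n" using A by auto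
  from spectrum_non_empty[OF C] n obtain k where "eigenvalue ?C k"
    unfolding spectrum_def by auto
  then obtain z where z: "z \<in> carrier_vec n" "z \<noteq> 0\<^sub>v n" "?C *\<^sub>v z = k \<cdot>\<^sub>v z"
    unfolding eigenvalue_def eigenvector_def using A by auto
  have zz: "conjugate z \<in> carrier_vec n" using z(1) by auto
  have Cz: "?C *\<^sub>v conjugate z = conjugate k \<cdot>\<^sub>v conjugate z"
  proof (rule eq_vecI)
    fix i assume i: "i < dim_vec (conjugate k \<cdot>\<^sub>v conjugate z)"
    then have i': "i < n" using z by auto
    have "(?C *\<^sub>v conjugate z) $ i = cnj ((?C *\<^sub>v z) $ i)"
      using i' A z(1) by (auto simp: scalar_prod_def intro!: sum.cong)
    also have "\<dots> = (conjugate k \<cdot>\<^sub>v conjugate z) $ i"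
      unfolding z(3) using i' z(1) by auto
    finally show "(?C *\<^sub>v conjugate z) $ i = (conjugate k \<cdot>\<^sub>v conjugate z) $ i" .
  qed (use A z in auto)
  have CT: "?C\<^sup>T = ?C" using sym by (metis map_mat_transpose)
  \<comment> \<open>Moving the symmetric real matrix across the product gives \<open>k\<close> times
    and \<open>conjugate k\<close> times the same nonzero number, so \<open>k\<close> is real. Being
    a root of the complexified characteristic polynomial, it is then a root of the real one.\<close>
  have "k * (z \<bullet> conjugate z) = (?C *\<^sub>v z) \<bullet> conjugate z"
    unfolding z(3) using z(1) zz by auto
  also have "\<dots> = z \<bullet> (?C *\<^sub>v conjugate z)"
    using transpose_vec_mult_scalar[OF C zz z(1)] CT by auto
  also have "\<dots> = conjugate k * (z \<bullet> conjugate z)"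
    unfolding Cz using z(1) zz by auto
  finally have "k = cnj k" using conjugate_square_eq_0_vec[OF z(1)] z(2) by auto
  then have kr: "k = of_real (Re k)" by (simp add: complex_eq_iff)
  have "poly (char_poly ?C) k = 0" using eigenvalue_root_char_poly[OF C] \<open>eigenvalue ?C k\<close> by auto
  then have "poly (map_poly of_real (char_poly A)) (complex_of_real (Re k)) = 0"
    using kr by (simp add: of_real_hom.char_poly_hom[OF A])
  then have "poly (char_poly A) (Re k) = 0" by simp
  then show ?thesis using eigenvalue_root_char_poly[OF A] by auto
qed

text \<open>Gram-Schmidt on a basis that starts with \<open>v\<close> leaves \<open>v\<close> in
  first place. Its output is orthogonal but not normalised; the factors \<open>g i\<close> normalise
  it, which is why the first column is only a multiple of \<open>v\<close>.\<close>

lemma orthogonal_mat_first_col: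
  fixes v :: "real vec"
  assumes v: "v \<in> carrier_vec n" "v \<noteq> 0\<^sub>v n"
  obtains Q where "Q \<in> carrier_mat n n" "Q\<^sup>T * Q = 1\<^sub>m n" "\<exists>r. col Q 0 = r \<cdot>\<^sub>v v"
proof -
  interpret cof_vec_space n "TYPE(real)" .
  have n: "0 < n" using v by (cases n) auto
  define ws where "ws = gram_schmidt n (basis_completion v)"
  note bc = basis_completion[OF v]
  note gs = gram_schmidt_result[OF bc(2,4,5) ws_def]
  have lw: "length ws = n" using gs(4) bc(6) by simp
  have h: "hd ws = v" unfolding ws_def basis_completion_def Let_def using v(1) by (rule gram_schmidt_hd)
  have w0: "ws ! 0 = v" using h lw n by (metis hd_conv_nth length_greater_0_conv)
  have wc: "ws ! i \<in> carrier_vec n" if "i < n" for i using gs(3) lw that by auto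
  define g where "g i = 1 / sqrt (ws ! i \<bullet> ws ! i)" for i
  define Q where "Q = mat_of_cols n (map (\<lambda>i. g i \<cdot>\<^sub>v ws ! i) [0..<n])"
  have Q: "Q \<in> carrier_mat n n" unfolding Q_def by auto
  have colQ: "col Q i = g i \<cdot>\<^sub>v ws ! i" if "i < n" for i
    unfolding Q_def using that wc by (subst col_mat_of_cols) auto
  have orth: "(ws ! i \<bullet> ws ! j = 0) = (i \<noteq> j)" if "i < n" "j < n" for i j
    using corthogonalD[OF gs(2), of i j] that lw
    by (simp add: conjugate_vec_def scalar_prod_def)
  have pos: "0 < ws ! i \<bullet> ws ! i" if "i < n" for i
    using orth[OF that that] by (simp add: scalar_prod_def sum_nonneg less_le)
  have "Q\<^sup>T * Q = 1\<^sub>m n"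
  proof (rule eq_matI)
    fix i j assume "i < dim_row (1\<^sub>m n :: real mat)" "j < dim_col (1\<^sub>m n :: real mat)"
    then have ij: "i < n" "j < n" by auto
    have "(Q\<^sup>T * Q) $$ (i, j) = col Q i \<bullet> col Q j" using ij Q by auto
    also have "\<dots> = g i * (g j * (ws ! i \<bullet> ws ! j))"
      unfolding colQ[OF ij(1)] colQ[OF ij(2)]
      using wc[OF ij(1)] wc[OF ij(2)]
      by (simp add: smult_scalar_prod_distrib[of _ n] scalar_prod_smult_distrib[of _ n])
    also have "\<dots> = (if i = j then 1 else 0)"
      using orth[OF ij] pos[OF ij(1)] by (auto simp: g_def)
    finally show "(Q\<^sup>T * Q) $$ (i, j) = 1\<^sub>m n $$ (i, j)" using ij by auto
  qed (use Q in auto)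
  moreover have "col Q 0 = g 0 \<cdot>\<^sub>v v" using colQ n w0 by auto
  ultimately show ?thesis using that Q by blast
qed

text \<open>Deflation by induction on the size: in an orthonormal basis starting with an
  eigenvector, the first column of the matrix is \<open>k\<close> followed by zeros, and symmetry
  forces the same for the first row. What remains is a symmetric block \<open>S\<close> of size one
  less.\<close>

lemma real_spectral:
  fixes A :: "real mat"
  assumes "A \<in> carrier_mat n n" and "A\<^sup>T = A"
  shows "\<exists>U l. U \<in> carrier_mat n n \<and> U\<^sup>T * U = 1\<^sub>m n \<and> A * U = U * mat_diag n l"
  using assms
proof (induction n arbitrary: A)
  case 0
  then show ?case by (intro exI[of _ "1\<^sub>m 0"] exI[of _ "\<lambda>_. 0"]) (auto simp: mat_diag_def intro!: eq_matI)
next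
  case (Suc n)
  note A = Suc.prems(1) and sym = Suc.prems(2)
  obtain k where "eigenvalue A k" using symmetric_real_eigenvalue[OF A sym] by auto
  then obtain v where v: "v \<in> carrier_vec (Suc n)" "v \<noteq> 0\<^sub>v (Suc n)" "A *\<^sub>v v = k \<cdot>\<^sub>v v"
    unfolding eigenvalue_def eigenvector_def using A by auto
  obtain Q r where Q: "Q \<in> carrier_mat (Suc n) (Suc n)" and QQ: "Q\<^sup>T * Q = 1\<^sub>m (Suc n)"
    and r: "col Q 0 = r \<cdot>\<^sub>v v"
    using orthogonal_mat_first_col[OF v(1,2)] by metis
  have QT: "Q\<^sup>T \<in> carrier_mat (Suc n) (Suc n)" using Q by auto
  have QQ': "Q * Q\<^sup>T = 1\<^sub>m (Suc n)" using mat_mult_left_right_inverse[OF QT Q QQ] .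
  have cQ: "col Q j \<in> carrier_vec (Suc n)" for j using Q by (metis carrier_matD(1) col_dim)
  define B where "B = Q\<^sup>T * (A * Q)"
  have AQ: "A * Q \<in> carrier_mat (Suc n) (Suc n)" using A Q by auto
  have B: "B \<in> carrier_mat (Suc n) (Suc n)" unfolding B_def using QT AQ by auto
  have "B\<^sup>T = B"
    unfolding B_def transpose_mult[OF QT AQ] transpose_mult[OF A Q] sym
    using assoc_mult_mat[OF QT A Q] by simp
  then have Bsym: "B $$ (i, j) = B $$ (j, i)" if "i < Suc n" "j < Suc n" for i j
    using that B by (metis carrier_matD index_transpose_mat(1))
  have colB: "B $$ (i, 0) = (if i = 0 then k else 0)" if i: "i < Suc n" for i
  proof -
    have "A *\<^sub>v col Q 0 = k \<cdot>\<^sub>v col Q 0"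
      unfolding r using v(1,3) A by (simp add: mult_mat_vec smult_smult_assoc mult.commute)
    then have "col (A * Q) 0 = k \<cdot>\<^sub>v col Q 0"
      using Q A by (subst col_mult2[OF A Q]) auto
    then have "B $$ (i, 0) = col Q i \<bullet> (k \<cdot>\<^sub>v col Q 0)"
      unfolding B_def using i Q A by auto
    also have "\<dots> = k * (col Q i \<bullet> col Q 0)"
      by (rule scalar_prod_smult_distrib[OF cQ cQ])
    also have "col Q i \<bullet> col Q 0 = (Q\<^sup>T * Q) $$ (i, 0)"
      using i Q by auto
    also have "\<dots> = (if i = 0 then 1 else 0)" unfolding QQ using i by auto
    finally show ?thesis by auto
  qed
  define S where "S = Matrix.mat n n (\<lambda>(i, j). B $$ (Suc i, Suc j))"
  have S: "S \<in> carrier_mat n n" by (simp add: S_def)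
  have SS: "S\<^sup>T = S" unfolding S_def by (rule eq_matI) (auto simp: Bsym)
  define K :: "real mat" where "K = mat_diag 1 (\<lambda>_. k)"
  have K: "K \<in> carrier_mat 1 1" by (simp add: K_def)
  have Bf: "B = four_block_mat K (0\<^sub>m 1 n) (0\<^sub>m n 1) S"
  proof (rule eq_matI)
    fix i j assume "i < dim_row (four_block_mat K (0\<^sub>m 1 n) (0\<^sub>m n 1) S)"
      "j < dim_col (four_block_mat K (0\<^sub>m 1 n) (0\<^sub>m n 1) S)"
    then have ij: "i < Suc n" "j < Suc n" using K S by auto
    show "B $$ (i, j) = four_block_mat K (0\<^sub>m 1 n) (0\<^sub>m n 1) S $$ (i, j)"
      using ij K S colB[OF ij(1)] colB[OF ij(2)] Bsym[OF ij]
      by (cases i; cases j) (auto simp: S_def K_def mat_diag_def)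
  qed (use B K S in auto)
  obtain V l where V: "V \<in> carrier_mat n n" "V\<^sup>T * V = 1\<^sub>m n" "S * V = V * mat_diag n l"
    using Suc.IH[OF S SS] by blast
  define F where "F = four_block_mat (1\<^sub>m 1) (0\<^sub>m 1 n) (0\<^sub>m n 1) V"
  define D where "D = mat_diag (Suc n) (\<lambda>i. case i of 0 \<Rightarrow> k | Suc i \<Rightarrow> l i)"
  have Df: "D = four_block_mat K (0\<^sub>m 1 n) (0\<^sub>m n 1) (mat_diag n l)"
    unfolding D_def K_def mat_diag_def by (rule eq_matI) (auto split: nat.split)
  have F: "F \<in> carrier_mat (Suc n) (Suc n)" unfolding F_def using V(1) 
    by (metis One_nat_def four_block_carrier_mat one_carrier_mat plus_1_eq_Suc)
  have D: "D \<in> carrier_mat (Suc n) (Suc n)" unfolding D_def by simp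
  have O: "(1\<^sub>m 1 :: real mat) \<in> carrier_mat 1 1" "(0\<^sub>m 1 n :: real mat) \<in> carrier_mat 1 n"
    "(0\<^sub>m n 1 :: real mat) \<in> carrier_mat n 1" by auto
  have BF: "B * F = F * D"
    unfolding Bf F_def Df
    apply (subst mult_four_block_mat[OF K O(2) O(3) S O(1) O(2) O(3) V(1)])
    apply (subst mult_four_block_mat[OF O(1) O(2) O(3) V(1) K O(2) O(3), of "mat_diag n l"])
     apply simp
    using K S V by (simp add: left_mult_zero_mat[OF mat_diag_dim])
  have FT: "F\<^sup>T = four_block_mat (1\<^sub>m 1) (0\<^sub>m 1 n) (0\<^sub>m n 1) (V\<^sup>T)"
    unfolding F_def by (subst transpose_four_block_mat[OF O V(1)]) auto
  have VT: "V\<^sup>T \<in> carrier_mat n n" using V by auto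
  have "F\<^sup>T * F = four_block_mat (1\<^sub>m 1) (0\<^sub>m 1 n) (0\<^sub>m n 1) (1\<^sub>m n)"
    unfolding FT unfolding F_def
    apply (subst mult_four_block_mat[OF O(1) O(2) O(3) VT O(1) O(2) O(3) V(1)])
    using V by simp
  then have FF: "F\<^sup>T * F = 1\<^sub>m (Suc n)" by simp
  let ?U = "Q * F"
  have U: "?U \<in> carrier_mat (Suc n) (Suc n)" using Q F by auto
  have "?U\<^sup>T * ?U = F\<^sup>T * Q\<^sup>T * (Q * F)" using transpose_mult[OF Q F] by simp
  also have "\<dots> = F\<^sup>T * (Q\<^sup>T * (Q * F))" using F Q by (intro assoc_mult_mat) auto
  also have "Q\<^sup>T * (Q * F) = Q\<^sup>T * Q * F" using F Q by (intro assoc_mult_mat[symmetric]) auto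
  finally have UU: "?U\<^sup>T * ?U = 1\<^sub>m (Suc n)" unfolding QQ using F FF by simp
  have "A * ?U = A * Q * F" using A Q F by (intro assoc_mult_mat[symmetric]) auto
  also have "A * Q = Q * Q\<^sup>T * (A * Q)" unfolding QQ' by (rule left_mult_one_mat[OF AQ, symmetric])
  also have "\<dots> = Q * B" unfolding B_def using Q QT AQ by (intro assoc_mult_mat) auto
  also have "Q * B * F = Q * (B * F)" using Q B F by (intro assoc_mult_mat) auto
  also have "\<dots> = ?U * D" unfolding BF using Q F D by (intro assoc_mult_mat[symmetric]) auto
  finally have "A * ?U = ?U * D" .
  then show ?case using U UU unfolding D_def by blast
qed

section \<open>Singular values and their perturbation\<close>

text \<open>Permuting the columns of \<open>U\<close> reorders the eigenvalues. Since the matrix is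
  similar to the diagonal one, its characteristic polynomial is the product of the linear factors,
  so the diagonal is the multiset of roots with multiplicities.\<close>

lemma real_spectral_sorted:
  fixes A :: "real mat"
  assumes A: "A \<in> carrier_mat n n" and sym: "A\<^sup>T = A"
  shows "\<exists>U l. U \<in> carrier_mat n n \<and> U\<^sup>T * U = 1\<^sub>m n \<and> A * U = U * mat_diag n l \<and>
    (\<forall>i j. i \<le> j \<longrightarrow> j < n \<longrightarrow> l j \<le> l i) \<and> proots (char_poly A) = mset (map l [0..<n])"
proof -
  obtain V k where V: "V \<in> carrier_mat n n" and VV: "V\<^sup>T * V = 1\<^sub>m n"
    and AV: "A * V = V * mat_diag n k"
    using real_spectral[OF A sym] by blast
  \<comment> \<open>Sorting by the negated eigenvalues makes the eigenvalues non-increasing along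
    \<open>p\<close>.\<close>
  define p where "p = sort_key (\<lambda>i. - k i) [0..<n]"
  have p: "length p = n" "distinct p" "set p = {0..<n}" by (simp_all add: p_def)
  have pn: "p ! i < n" if "i < n" for i using p that nth_mem by fastforce
  define l where "l i = k (p ! i)" for i
  define U where "U = Matrix.mat n n (\<lambda>(i, j). V $$ (i, p ! j))"
  have U: "U \<in> carrier_mat n n" by (simp add: U_def)
  have colU: "col U j = col V (p ! j)" if "j < n" for j
    using that V pn[OF that] by (auto simp: U_def)
  have UU: "U\<^sup>T * U = 1\<^sub>m n"
  proof (rule eq_matI)
    fix i j assume "i < dim_row (1\<^sub>m n :: real mat)" "j < dim_col (1\<^sub>m n :: real mat)"
    then have ij: "i < n" "j < n" by auto
    have "(U\<^sup>T * U) $$ (i, j) = col V (p ! i) \<bullet> col V (p ! j)"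
      using ij U colU by auto
    also have "\<dots> = (V\<^sup>T * V) $$ (p ! i, p ! j)" using V pn ij by auto
    also have "\<dots> = (1\<^sub>m n) $$ (i, j)"
      unfolding VV using pn[OF ij(1)] pn[OF ij(2)] ij p by (simp add: nth_eq_iff_index_eq)
    finally show "(U\<^sup>T * U) $$ (i, j) = (1\<^sub>m n) $$ (i, j)" .
  qed (use U in auto)
  have AU: "A * U = U * mat_diag n l"
  proof (rule eq_matI)
    fix i j assume "i < dim_row (U * mat_diag n l)" "j < dim_col (U * mat_diag n l)"
    then have ij: "i < n" "j < n" using U by (auto simp: mat_diag_def)
    have "(A * U) $$ (i, j) = (A * V) $$ (i, p ! j)"
      using ij A U V pn colU by auto
    also have "\<dots> = V $$ (i, p ! j) * k (p ! j)"
      unfolding AV mat_diag_mult_right[OF V] using ij pn by auto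
    also have "\<dots> = (U * mat_diag n l) $$ (i, j)"
      unfolding mat_diag_mult_right[OF U] using ij by (auto simp: U_def l_def)
    finally show "(A * U) $$ (i, j) = (U * mat_diag n l) $$ (i, j)" .
  qed (use A U in \<open>auto simp: mat_diag_def\<close>)
  have sorted: "l j \<le> l i" if "i \<le> j" "j < n" for i j
    using sorted_nth_mono[of "map (\<lambda>i. - k i) p" i j] that p(1)
    by (simp add: l_def p_def)
  have UT: "U\<^sup>T \<in> carrier_mat n n" using U by auto
  have UU': "U * U\<^sup>T = 1\<^sub>m n" using mat_mult_left_right_inverse[OF UT U UU] .
  let ?D = "mat_diag n l"
  have "U * ?D * U\<^sup>T = A * (U * U\<^sup>T)"
    unfolding AU[symmetric] using A U UT by (intro assoc_mult_mat) auto
  then have "A = U * ?D * U\<^sup>T" unfolding UU' using A by simp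
  then have "similar_mat A ?D"
    using A U UT UU UU' by (intro similar_matI[where P = U and Q = "U\<^sup>T"]) auto
  then have "char_poly A = char_poly ?D" by (rule char_poly_similar)
  also have "\<dots> = (\<Prod>a\<leftarrow>diag_mat ?D. [:- a, 1:])"
    by (intro char_poly_upper_triangular[of _ n])
       (auto simp: mat_diag_def upper_triangular_def)
  also have "diag_mat ?D = map l [0..<n]"
    by (auto simp: diag_mat_def mat_diag_def)
  finally have cp: "char_poly A = (\<Prod>a\<leftarrow>map l [0..<n]. [:- a, 1:])" .
  have "proots (\<Prod>a\<leftarrow>xs. [:- a, 1:]) = mset xs" for xs :: "real list"
  proof (induction xs)
    case (Cons a xs)
    have "(\<Prod>a\<leftarrow>xs. [:- a, 1:]) \<noteq> 0" by (auto simp: prod_list_zero_iff)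
    then show ?case using Cons.IH by (simp add: proots_mult del: mult_pCons_left)
  qed simp
  then have "proots (char_poly A) = mset (map l [0..<n])" unfolding cp .
  then show ?thesis using U UU AU sorted by blast
qed

lemma scalar_prod_ge_0_real: "0 \<le> v \<bullet> (v :: real vec)"
  by (simp add: scalar_prod_def sum_nonneg)

text \<open>Pythagoras: a diagonal Gram matrix means that the columns of \<open>Y\<close> are
  orthogonal with squared norms \<open>l k\<close>. With \<open>l = 1\<close> this is the isometry
  property of orthogonal matrices.\<close>

lemma scalar_prod_diag:
  fixes Y :: "real mat"
  assumes Y: "Y \<in> carrier_mat m n" and YY: "Y\<^sup>T * Y = mat_diag n l" and c: "c \<in> carrier_vec n"
  shows "(Y *\<^sub>v c) \<bullet> (Y *\<^sub>v c) = (\<Sum>k<n. l k * (c $ k)\<^sup>2)"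
proof -
  have Yc: "Y *\<^sub>v c \<in> carrier_vec m" using Y c by auto
  have "(Y *\<^sub>v c) \<bullet> (Y *\<^sub>v c) = (Y\<^sup>T *\<^sub>v (Y *\<^sub>v c)) \<bullet> c"
    using transpose_vec_mult_scalar[OF Y c Yc] by simp
  also have "Y\<^sup>T *\<^sub>v (Y *\<^sub>v c) = mat_diag n l *\<^sub>v c"
    unfolding YY[symmetric] using Y c by (intro assoc_mult_mat_vec[symmetric]) auto
  also have "(mat_diag n l *\<^sub>v c) \<bullet> c = (\<Sum>k<n. l k * (c $ k)\<^sup>2)"
  proof -
    have "(mat_diag n l *\<^sub>v c) $ k = l k * c $ k" if "k < n" for k
    proof -
      have "(mat_diag n l *\<^sub>v c) $ k = (\<Sum>j\<in>{0..<n}. (if k = j then l j else 0) * c $ j)"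
        using that c by (simp add: mat_diag_def scalar_prod_def)
      also have "\<dots> = (\<Sum>j\<in>{0..<n}. if k = j then l j * c $ j else 0)"
        by (intro sum.cong) auto
      finally show ?thesis using that by simp
    qed
    then show ?thesis using c
      by (auto simp: scalar_prod_def power2_eq_square lessThan_atLeast0 mult.assoc intro!: sum.cong)
  qed
  finally show ?thesis .
qed

text \<open>The columns of \<open>U\<close> are right singular vectors, so the Gram matrix of
  \<open>A * U\<close> is the diagonalised \<open>A\<^sup>T * A\<close>. The sequence
  \<open>\<sigma>\<close> covers all \<open>n\<close> indices although the list stops at
  \<open>min m n\<close>, because expanding a vector in this basis involves all of them.\<close>

lemma singular_values_basis:
  fixes A :: "real mat"
  assumes A: "A \<in> carrier_mat m n"
  obtains U \<sigma> where "U \<in> carrier_mat n n" "U\<^sup>T * U = 1\<^sub>m n"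
    "(A * U)\<^sup>T * (A * U) = mat_diag n (\<lambda>k. (\<sigma> k)\<^sup>2)"
    "\<And>i j. i \<le> j \<Longrightarrow> j < n \<Longrightarrow> \<sigma> j \<le> \<sigma> i" "\<And>j. 0 \<le> \<sigma> j"
    "singular_values A = map \<sigma> [0..<min m n]"
proof -
  let ?S = "A\<^sup>T * A"
  have AT: "A\<^sup>T \<in> carrier_mat n m" using A by auto
  have S: "?S \<in> carrier_mat n n" using A by auto
  have sym: "?S\<^sup>T = ?S" using transpose_mult[OF AT A] by simp
  obtain U l where U: "U \<in> carrier_mat n n" and UU: "U\<^sup>T * U = 1\<^sub>m n"
    and SU: "?S * U = U * mat_diag n l"
    and sorted: "\<And>i j. i \<le> j \<Longrightarrow> j < n \<Longrightarrow> l j \<le> l i"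
    and roots: "proots (char_poly ?S) = mset (map l [0..<n])"
    using real_spectral_sorted[OF S sym] by blast
  have UT: "U\<^sup>T \<in> carrier_mat n n" and AU: "A * U \<in> carrier_mat m n" using A U by auto
  have "(A * U)\<^sup>T * (A * U) = U\<^sup>T * A\<^sup>T * (A * U)" by (simp only: transpose_mult[OF A U])
  also have "\<dots> = U\<^sup>T * (A\<^sup>T * (A * U))" using UT AT AU by (rule assoc_mult_mat)
  also have "A\<^sup>T * (A * U) = ?S * U" using AT A U by (rule assoc_mult_mat[symmetric])
  also have "U\<^sup>T * (?S * U) = U\<^sup>T * U * mat_diag n l"
    unfolding SU using UT U mat_diag_dim by (rule assoc_mult_mat[symmetric])
  finally have YY: "(A * U)\<^sup>T * (A * U) = mat_diag n l"
    unfolding UU by (simp add: left_mult_one_mat[OF mat_diag_dim])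
  have l0: "0 \<le> l k" if "k < n" for k
  proof -
    have "l k = ((A * U)\<^sup>T * (A * U)) $$ (k, k)" unfolding YY using that by (simp add: mat_diag_def)
    also have "\<dots> = col (A * U) k \<bullet> col (A * U) k" using AU that by auto
    finally show ?thesis by (simp add: scalar_prod_ge_0_real)
  qed
  \<comment> \<open>The value 0 from \<open>n\<close> on makes nonnegativity hold for every
    index.\<close>
  define \<sigma> where "\<sigma> k = sqrt (if k < n then l k else 0)" for k
  have "sorted (rev (map \<sigma> [0..<n]))"
    unfolding sorted_rev_iff_nth_mono using sorted by (auto simp: \<sigma>_def)
  moreover have "mset (rev (map \<sigma> [0..<n])) = mset (map (sqrt \<circ> l) [0..<n])"
    by (auto simp: \<sigma>_def comp_def intro!: image_mset_cong)
  ultimately have "sort (map (sqrt \<circ> l) [0..<n]) = rev (map \<sigma> [0..<n])"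
    by (intro properties_for_sort) auto
  then have "sorted_list_of_multiset (image_mset sqrt (proots (char_poly ?S))) = rev (map \<sigma> [0..<n])"
    unfolding roots by (simp flip: mset_map)
  then have sv: "singular_values A = map \<sigma> [0..<min m n]"
    unfolding singular_values_def using A by (simp add: take_map min_def)
  have "mat_diag n l = mat_diag n (\<lambda>k. (\<sigma> k)\<^sup>2)"
    unfolding mat_diag_def by (rule eq_matI) (auto simp: \<sigma>_def l0)
  then show ?thesis
    using that[OF U UU _ _ _ sv] YY sorted l0 by (auto simp: \<sigma>_def)
qed

definition vnorm :: "real vec \<Rightarrow> real" where
  "vnorm v = sqrt (v \<bullet> v)"

text \<open>The Courant-Fischer argument: a single nonzero \<open>x\<close> satisfies both
  \<open>\<sigma> i * vnorm x \<le> vnorm (A *\<^sub>v x)\<close> and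
  \<open>vnorm (B *\<^sub>v x) \<le> \<tau> i * vnorm x\<close>. The hypothesis is one-sided, so
  that using it in both orders of the two matrices gives the two-sided Weyl bound.\<close>

lemma singular_values_perturb:
  fixes A B :: "real mat"
  assumes A: "A \<in> carrier_mat m n" and B: "B \<in> carrier_mat m n"
    and le: "\<And>x. x \<in> carrier_vec n \<Longrightarrow> vnorm (A *\<^sub>v x) \<le> vnorm (B *\<^sub>v x) + t * vnorm x"
    and i: "i < min m n"
  shows "singular_values A ! i \<le> singular_values B ! i + t"
proof -
  obtain U \<sigma> where U: "U \<in> carrier_mat n n" "U\<^sup>T * U = 1\<^sub>m n"
    "(A * U)\<^sup>T * (A * U) = mat_diag n (\<lambda>k. (\<sigma> k)\<^sup>2)"
    and \<sigma>: "\<And>i j. i \<le> j \<Longrightarrow> j < n \<Longrightarrow> \<sigma> j \<le> \<sigma> i" "\<And>j. 0 \<le> \<sigma> j"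
    and svA: "singular_values A = map \<sigma> [0..<min m n]"
    using singular_values_basis[OF A] by blast
  obtain V \<tau> where V: "V \<in> carrier_mat n n" "V\<^sup>T * V = 1\<^sub>m n"
    "(B * V)\<^sup>T * (B * V) = mat_diag n (\<lambda>k. (\<tau> k)\<^sup>2)"
    and \<tau>: "\<And>i j. i \<le> j \<Longrightarrow> j < n \<Longrightarrow> \<tau> j \<le> \<tau> i" "\<And>j. 0 \<le> \<tau> j"
    and svB: "singular_values B = map \<tau> [0..<min m n]"
    using singular_values_basis[OF B] by blast
  have VT: "V\<^sup>T \<in> carrier_mat n n" using V by auto
  have VV': "V * V\<^sup>T = 1\<^sub>m n" using mat_mult_left_right_inverse[OF VT V(1,2)] .
  have AU: "A * U \<in> carrier_mat m n" and BV: "B * V \<in> carrier_mat m n"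
    and VU: "V\<^sup>T * U \<in> carrier_mat n n" using A U B V by auto
  \<comment> \<open>Min-max argument: a kernel vector \<open>d\<close> of the singular matrix \<open>G\<close> gives \<open>x = U d\<close> in the span
    of the top \<open>i + 1\<close> right singular vectors of \<open>A\<close> and orthogonal to the top \<open>i\<close> of \<open>B\<close>.\<close>
  define G where "G = Matrix.mat n n (\<lambda>(k, j). if k < i then (V\<^sup>T * U) $$ (k, j)
    else if k = i then 0 else if k = j then 1 else 0)"
  have G: "G \<in> carrier_mat n n" by (simp add: G_def)
  \<comment> \<open>Row \<open>i\<close> of \<open>G\<close> is zero: the other rows impose only
    \<open>n - 1\<close> linear conditions on \<open>n\<close> unknowns, namely \<open>i\<close> for
    orthogonality and \<open>n - 1 - i\<close> for vanishing coordinates.\<close>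
  have "G\<^sup>T *\<^sub>v unit_vec n i = 0\<^sub>v n"
    using i G by (intro eq_vecI) (auto simp: G_def)
  moreover have "unit_vec n i \<noteq> (0\<^sub>v n :: real vec)" using i by simp
  ultimately have "det (G\<^sup>T) = 0"
    using det_0_iff_vec_prod_zero[of "G\<^sup>T" n] G by (auto intro!: exI[of _ "unit_vec n i"])
  then have "det G = 0" using det_transpose[OF G] by simp
  then obtain d where d: "d \<in> carrier_vec n" "d \<noteq> 0\<^sub>v n" "G *\<^sub>v d = 0\<^sub>v n"
    using det_0_iff_vec_prod_zero[OF G] by auto
  define x where "x = U *\<^sub>v d"
  define y where "y = V\<^sup>T *\<^sub>v x"
  have x: "x \<in> carrier_vec n" and y: "y \<in> carrier_vec n" using U V d by (auto simp: x_def y_def)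
  have "V *\<^sub>v y = V * V\<^sup>T *\<^sub>v x" unfolding y_def using V x by simp
  then have xVy: "x = V *\<^sub>v y" unfolding VV' using x by simp
  have mv: "(C *\<^sub>v d) $ k = (\<Sum>j\<in>{0..<n}. C $$ (k, j) * d $ j)"
    if "C \<in> carrier_mat n n" "k < n" for C k
    using that d(1) by (auto simp: scalar_prod_def intro!: sum.cong)
  have d0: "d $ k = 0" if "i < k" "k < n" for k
  proof -
    have "0 = (G *\<^sub>v d) $ k" using d(3) that by simp
    also have "\<dots> = (\<Sum>j\<in>{0..<n}. (if k = j then 1 else 0) * d $ j)"
      using that d(1) by (simp add: G_def scalar_prod_def)
    also have "\<dots> = (\<Sum>j\<in>{0..<n}. if k = j then d $ j else 0)" by (intro sum.cong) auto
    finally show ?thesis using that by simp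
  qed
  have y0: "y $ k = 0" if "k < i" for k
  proof -
    have kn: "k < n" using that i by simp
    have "0 = (G *\<^sub>v d) $ k" using d(3) kn by simp
    also have "\<dots> = (\<Sum>j\<in>{0..<n}. (V\<^sup>T * U) $$ (k, j) * d $ j)"
      using that kn d(1) by (simp add: G_def scalar_prod_def)
    also have "\<dots> = ((V\<^sup>T * U) *\<^sub>v d) $ k"
      using mv[OF VU kn] by simp
    also have "(V\<^sup>T * U) *\<^sub>v d = y" unfolding y_def x_def using U(1) V(1) d(1) by simp
    finally show ?thesis by simp
  qed
  have xx: "x \<bullet> x = (\<Sum>k<n. (d $ k)\<^sup>2)"
    unfolding x_def using scalar_prod_diag[of U n n "\<lambda>_. 1" d] U d by simp
  have xx': "x \<bullet> x = (\<Sum>k<n. (y $ k)\<^sup>2)"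
    unfolding xVy using scalar_prod_diag[of V n n "\<lambda>_. 1" y] V y by simp
  have "A *\<^sub>v x = (A * U) *\<^sub>v d" unfolding x_def using A U d by simp
  then have Ax: "(A *\<^sub>v x) \<bullet> (A *\<^sub>v x) = (\<Sum>k<n. (\<sigma> k)\<^sup>2 * (d $ k)\<^sup>2)"
    using scalar_prod_diag[OF AU U(3) d(1)] by simp
  have "B *\<^sub>v x = (B * V) *\<^sub>v y" unfolding xVy using B V y by simp
  then have Bx: "(B *\<^sub>v x) \<bullet> (B *\<^sub>v x) = (\<Sum>k<n. (\<tau> k)\<^sup>2 * (y $ k)\<^sup>2)"
    using scalar_prod_diag[OF BV V(3) y] by simp
  \<comment> \<open>Only the coordinates \<open>k \<le> i\<close> of \<open>d\<close> survive, and
    there \<open>\<sigma> k\<close> is at least \<open>\<sigma> i\<close>. Dually, \<open>y\<close>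
    lives on the coordinates \<open>k \<ge> i\<close>, where \<open>\<tau> k\<close> is at most
    \<open>\<tau> i\<close>.\<close>
  have "(\<sigma> i)\<^sup>2 * (x \<bullet> x) \<le> (A *\<^sub>v x) \<bullet> (A *\<^sub>v x)"
    unfolding Ax xx sum_distrib_left
  proof (intro sum_mono)
    fix k assume "k \<in> {..<n}"
    then show "(\<sigma> i)\<^sup>2 * (d $ k)\<^sup>2 \<le> (\<sigma> k)\<^sup>2 * (d $ k)\<^sup>2"
      using d0[of k] \<sigma>(1)[of k i] \<sigma>(2) i
      by (cases "k \<le> i") (auto intro!: mult_right_mono power_mono)
  qed
  then have 1: "\<sigma> i * vnorm x \<le> vnorm (A *\<^sub>v x)"
    unfolding vnorm_def using \<sigma>(2)[of i]
    by (metis real_sqrt_le_iff real_sqrt_mult real_sqrt_unique)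
  have "(B *\<^sub>v x) \<bullet> (B *\<^sub>v x) \<le> (\<tau> i)\<^sup>2 * (x \<bullet> x)"
    unfolding Bx xx' sum_distrib_left
  proof (intro sum_mono)
    fix k assume "k \<in> {..<n}"
    then show "(\<tau> k)\<^sup>2 * (y $ k)\<^sup>2 \<le> (\<tau> i)\<^sup>2 * (y $ k)\<^sup>2"
      using y0[of k] \<tau>(1)[of i k] \<tau>(2) i
      by (cases "k < i") (auto intro!: mult_right_mono power_mono)
  qed
  then have 2: "vnorm (B *\<^sub>v x) \<le> \<tau> i * vnorm x"
    unfolding vnorm_def using \<tau>(2)[of i]
    by (metis real_sqrt_le_iff real_sqrt_mult real_sqrt_unique)
  \<comment> \<open>\<open>U\<close> is an isometry, so \<open>d \<noteq> 0\<close> gives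
    \<open>x\<close> a positive norm by which the inequality can be divided.\<close>
  obtain k where k: "k < n" "d $ k \<noteq> 0" using d(1,2) by (metis carrier_vecD eq_vecI index_zero_vec)
  then have "0 < (\<Sum>k<n. (d $ k)\<^sup>2)" by (intro sum_pos2[of _ k]) auto
  then have pos: "0 < vnorm x" unfolding vnorm_def xx by simp
  have "\<sigma> i * vnorm x \<le> (\<tau> i + t) * vnorm x"
    using 1 2 le[OF x] by (simp add: algebra_simps)
  then have "\<sigma> i \<le> \<tau> i + t" using pos by simp
  then show ?thesis using i by (simp add: svA svB)
qed

section \<open>Rank\<close>

text \<open>\<open>U\<close> is invertible, so \<open>A\<close> and \<open>A * U\<close> have the
  same column space.\<close>

lemma rank_mult_orthogonal:
  fixes A :: "real mat"
  assumes A: "A \<in> carrier_mat m n" and U: "U \<in> carrier_mat n n" "U\<^sup>T * U = 1\<^sub>m n"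
  shows "vec_space.rank m (A * U) = vec_space.rank m A"
proof -
  interpret vec_space "TYPE(real)" m .
  have UT: "U\<^sup>T \<in> carrier_mat n n" using U by auto
  have UU': "U * U\<^sup>T = 1\<^sub>m n" using mat_mult_left_right_inverse[OF UT U] .
  have AU: "A * U \<in> carrier_mat m n" using A U by auto
  have "\<exists>y\<in>carrier_vec n. (A * U) *\<^sub>v y = A *\<^sub>v x" if x: "x \<in> carrier_vec n" for x
  proof (rule bexI)
    have "(A * U) *\<^sub>v (U\<^sup>T *\<^sub>v x) = A *\<^sub>v (U *\<^sub>v (U\<^sup>T *\<^sub>v x))"
      using A U UT x by (intro assoc_mult_mat_vec) auto
    also have "U *\<^sub>v (U\<^sup>T *\<^sub>v x) = U * U\<^sup>T *\<^sub>v x"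
      using U(1) UT x by (intro assoc_mult_mat_vec[symmetric]) auto
    finally show "(A * U) *\<^sub>v (U\<^sup>T *\<^sub>v x) = A *\<^sub>v x" unfolding UU' using x by simp
  qed (use UT x in auto)
  moreover have "\<exists>y\<in>carrier_vec n. A *\<^sub>v y = (A * U) *\<^sub>v x" if x: "x \<in> carrier_vec n" for x
    using assoc_mult_mat_vec[OF A U(1) x] U(1) x by (intro bexI[of _ "U *\<^sub>v x"]) auto
  ultimately have "col_space (A * U) = col_space A"
    unfolding col_space_eq[OF AU] col_space_eq[OF A] using A U AU by auto
  then show ?thesis unfolding rank_def col_space_def by simp
qed

text \<open>Pairing a vanishing combination with a member \<open>v\<close> leaves only the term
  \<open>a v * (v \<bullet> v)\<close>.\<close>

lemma orthogonal_lin_indpt: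
  fixes S :: "real vec set"
  assumes S: "finite S" "S \<subseteq> carrier_vec m" "\<And>v. v \<in> S \<Longrightarrow> v \<bullet> v \<noteq> 0"
    and orth: "\<And>v w. v \<in> S \<Longrightarrow> w \<in> S \<Longrightarrow> v \<noteq> w \<Longrightarrow> v \<bullet> w = 0"
  shows "\<not> module.lin_dep class_ring (module_vec TYPE(real) m) S"
proof -
  interpret vec_space "TYPE(real)" m .
  have "\<forall>v\<in>S. a v = 0" if a: "lincomb a S = 0\<^sub>v m" for a
  proof
    fix v assume v: "v \<in> S"
    have vc: "v \<in> carrier_vec m" using v S by auto
    have "0 = (\<Sum>i\<in>{0..<m}. lincomb a S $ i * v $ i)" unfolding a by simp
    also have "\<dots> = (\<Sum>i\<in>{0..<m}. (\<Sum>x\<in>S. a x * x $ i) * v $ i)"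
      using lincomb_index[OF _ S(2)] by auto
    also have "\<dots> = (\<Sum>i\<in>{0..<m}. \<Sum>x\<in>S. a x * (x $ i * v $ i))"
      by (simp add: sum_distrib_right mult.assoc)
    also have "\<dots> = (\<Sum>x\<in>S. \<Sum>i\<in>{0..<m}. a x * (x $ i * v $ i))" by (rule sum.swap)
    also have "\<dots> = (\<Sum>x\<in>S. a x * (x \<bullet> v))"
      using vc by (simp add: scalar_prod_def sum_distrib_left)
    also have "\<dots> = (\<Sum>x\<in>{v}. a x * (x \<bullet> v))"
      using S(1) v orth by (intro sum.mono_neutral_right) auto
    finally show "a v = 0" using S(3)[OF v] by simp
  qed
  then show ?thesis using S(1,2) by (intro finite_lin_indpt2) (auto simp: module_vec_simps)
qed

text \<open>The columns with \<open>l k \<noteq> 0\<close> are nonzero and orthogonal, hence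
  independent. They are maximal among the columns, since every other column is the zero vector. The
  bound by \<open>m\<close> comes from the dimension and later ensures that truncating to
  \<open>min m n\<close> loses no positive singular value.\<close>

lemma rank_gram_diag:
  fixes Y :: "real mat"
  assumes Y: "Y \<in> carrier_mat m n" and YY: "Y\<^sup>T * Y = mat_diag n l"
  shows "vec_space.rank m Y = card {k. k < n \<and> l k \<noteq> 0}" "card {k. k < n \<and> l k \<noteq> 0} \<le> m"
proof -
  interpret vec_space "TYPE(real)" m .
  let ?I = "{k. k < n \<and> l k \<noteq> 0}"
  let ?S = "col Y ` ?I"
  have ip: "col Y i \<bullet> col Y j = (if i = j then l j else 0)" if "i < n" "j < n" for i j
  proof -
    have "col Y i \<bullet> col Y j = (Y\<^sup>T * Y) $$ (i, j)" using that Y by auto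
    then show ?thesis unfolding YY using that by (simp add: mat_diag_def)
  qed
  \<comment> \<open>Two equal columns with different indices would be orthogonal and yet have the
    nonzero product \<open>l i\<close>.\<close>
  have inj: "inj_on (col Y) ?I"
  proof (rule inj_onI)
    fix i j assume ij: "i \<in> ?I" "j \<in> ?I" "col Y i = col Y j"
    have "col Y i \<bullet> col Y j \<noteq> 0" using ip[of i i] ij by simp
    then show "i = j" using ip[of i j] ij by (auto split: if_splits)
  qed
  have "col Y k \<in> carrier_vec m" for k using col_dim[of Y k] Y by simp
  then have Sc: "?S \<subseteq> carrier_vec m" by blast
  have li: "lin_indpt ?S"
  proof (rule orthogonal_lin_indpt[OF _ Sc])
    fix v assume "v \<in> ?S"
    then show "v \<bullet> v \<noteq> 0" using ip by force
  next
    fix v w assume "v \<in> ?S" "w \<in> ?S" "v \<noteq> w"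
    then obtain i j where "i < n" "j < n" "v = col Y i" "w = col Y j" "i \<noteq> j" by auto
    then show "v \<bullet> w = 0" using ip[of i j] by simp
  qed simp
  have S_cols: "?S \<subseteq> set (cols Y)" using Y by (auto simp: cols_def)
  have "maximal ?S (\<lambda>T. T \<subseteq> set (cols Y) \<and> lin_indpt T)"
    unfolding maximal_def
  proof (intro conjI allI impI S_cols li)
    fix T assume T: "?S \<subseteq> T \<and> T \<subseteq> set (cols Y) \<and> lin_indpt T"
    have Tc: "T \<subseteq> carrier_vec m" using T Y cols_dim by blast
    have "0\<^sub>v m \<notin> T" using zero_nin_lin_indpt[of T] T Tc by (auto simp: module_vec_simps class_ring_simps)
    have "v \<in> ?S" if v: "v \<in> T" for v
    proof -
      obtain k where k: "k < n" "v = col Y k" using v T Y by (auto simp: cols_def)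
      have "l k \<noteq> 0"
      proof
        assume "l k = 0"
        then have "v \<bullet> v = 0" using ip[OF k(1) k(1)] k by simp
        then have "v \<bullet>c v = 0" by (simp add: conjugate_vec_def scalar_prod_def)
        then have "v = 0\<^sub>v m" using conjugate_square_eq_0_vec[of v m] v Tc by auto
        then show False using v \<open>0\<^sub>v m \<notin> T\<close> by simp
      qed
      then show ?thesis using k by auto
    qed
    then show "T = ?S" using T by auto
  qed
  then have "rank Y = card ?S" by (rule rank_card_indpt[OF Y])
  then show "rank Y = card ?I" using card_image[OF inj] by simp
  have "card ?S \<le> dim" using li Sc by (intro li_le_dim) (auto simp: module_vec_simps)
  then show "card ?I \<le> m" using card_image[OF inj] dim_is_n by simp
qed

lemma down_closed_eq_lessThan:
  fixes S :: "nat set"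
  assumes "finite S" "\<And>i j. i \<le> j \<Longrightarrow> j \<in> S \<Longrightarrow> i \<in> S"
  shows "S = {..<card S}"
proof -
  have "k < card S" if "k \<in> S" for k
  proof -
    have "{..k} \<subseteq> S" using assms(2) that by auto
    then have "card {..k} \<le> card S" using assms(1) by (intro card_mono)
    then show ?thesis by simp
  qed
  then have "S \<subseteq> {..<card S}" by auto
  then show ?thesis by (simp add: card_subset_eq)
qed

text \<open>The rank of \<open>A\<close> equals that of \<open>A * U\<close>, whose Gram matrix is
  diagonal, so it counts the nonzero \<open>\<sigma> k\<close>. As \<open>\<sigma>\<close> is
  non-increasing, these are exactly the first \<open>r\<close> indices.\<close>

lemma singular_values_rank:
  fixes A :: "real mat"
  assumes A: "A \<in> carrier_mat m n"
  defines "r \<equiv> vec_space.rank m A"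
  shows "length (filter (\<lambda>s. 0 < s) (singular_values A)) = r" "r \<le> min m n"
    "\<And>j. r \<le> j \<Longrightarrow> j < min m n \<Longrightarrow> singular_values A ! j = 0"
proof -
  obtain U \<sigma> where U: "U \<in> carrier_mat n n" "U\<^sup>T * U = 1\<^sub>m n"
    and YY: "(A * U)\<^sup>T * (A * U) = mat_diag n (\<lambda>k. (\<sigma> k)\<^sup>2)"
    and \<sigma>: "\<And>i j. i \<le> j \<Longrightarrow> j < n \<Longrightarrow> \<sigma> j \<le> \<sigma> i" "\<And>j. 0 \<le> \<sigma> j"
    and sv: "singular_values A = map \<sigma> [0..<min m n]"
    using singular_values_basis[OF A] by blast
  define I where "I = {k. k < n \<and> (\<sigma> k)\<^sup>2 \<noteq> 0}"
  have AU: "A * U \<in> carrier_mat m n" using A U by auto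
  have r: "r = card I" and rm: "card I \<le> m"
    using rank_gram_diag[OF AU YY] rank_mult_orthogonal[OF A U] by (simp_all add: I_def r_def)
  have "i \<in> I" if "i \<le> j" "j \<in> I" for i j
  proof -
    have "0 < \<sigma> j" using that \<sigma>(2)[of j] by (simp add: I_def less_le)
    then show ?thesis using that \<sigma>(1)[of i j] by (auto simp: I_def)
  qed
  then have I: "I = {..<r}" unfolding r by (intro down_closed_eq_lessThan) (auto simp: I_def)
  have "card I \<le> card {..<n}" by (intro card_mono) (auto simp: I_def)
  then show rmn: "r \<le> min m n" using rm r by simp
  have pos: "0 < \<sigma> k \<longleftrightarrow> k < r" if "k < n" for k
  proof -
    have "0 < \<sigma> k \<longleftrightarrow> k \<in> I" using that \<sigma>(2)[of k] by (auto simp: I_def less_le)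
    then show ?thesis unfolding I by simp
  qed
  show "singular_values A ! j = 0" if "r \<le> j" "j < min m n" for j
    using pos[of j] that \<sigma>(2)[of j] by (simp add: sv)
  have "length (filter (\<lambda>s. 0 < s) (singular_values A)) = length (filter (\<lambda>k. 0 < \<sigma> k) [0..<min m n])"
    by (simp add: sv filter_map comp_def)
  also have "filter (\<lambda>k. 0 < \<sigma> k) [0..<min m n] = filter (\<lambda>k. k < r) [0..<min m n]"
    by (intro filter_cong) (auto simp: pos)
  also have "length \<dots> = card {k. k < min m n \<and> k < r}"
    by (subst length_filter_conv_card) (auto intro!: arg_cong[where f = card])
  also have "{k. k < min m n \<and> k < r} = {..<r}" using rmn by auto
  finally show "length (filter (\<lambda>s. 0 < s) (singular_values A)) = r" by simp
qed

section \<open>Index blocks and the rank of the blown up matrix\<close>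

lemma block_of_less:
  assumes "k < (\<Sum>i<a. \<mu> i)"
  shows "block_of \<mu> k < a"
proof -
  have "0 < a" using assms by (cases a) auto
  then have "k < (\<Sum>t\<le>a - 1. \<mu> t)" using assms by (cases a) (auto simp: lessThan_Suc_atMost)
  then have "block_of \<mu> k \<le> a - 1" unfolding block_of_def by (rule Least_le)
  then show ?thesis using \<open>0 < a\<close> by simp
qed

text \<open>The witness is the first index of block \<open>i\<close>, the sum of the preceding
  sizes; it belongs to that block because the block is nonempty.\<close>

lemma block_of_surj:
  assumes "0 < \<mu> i" "i < a"
  shows "\<exists>k<(\<Sum>i<a. \<mu> i). block_of \<mu> k = i"
proof (intro exI conjI)
  let ?k = "\<Sum>t<i. \<mu> t"
  have "?k < (\<Sum>t\<le>i. \<mu> t)" using assms by (simp flip: lessThan_Suc_atMost)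
  also have "\<dots> \<le> (\<Sum>i<a. \<mu> i)" using assms by (intro sum_mono2) auto
  finally show "?k < (\<Sum>i<a. \<mu> i)" .
  show "block_of \<mu> ?k = i" unfolding block_of_def
  proof (rule Least_equality)
    show "?k < (\<Sum>t\<le>i. \<mu> t)" using assms by (simp flip: lessThan_Suc_atMost)
    fix y assume y: "?k < (\<Sum>t\<le>y. \<mu> t)"
    show "i \<le> y"
    proof (rule ccontr)
      assume "\<not> i \<le> y"
      then have "(\<Sum>t\<le>y. \<mu> t) \<le> ?k" by (intro sum_mono2) auto
      then show False using y by simp
    qed
  qed
qed

text \<open>Repeating coordinates along a surjective \<open>b\<close> is an injective linear map, so
  it preserves and reflects linear independence. The rank depends only on the set of columns, hence
  comparing sets takes care of repeated columns at the same time as of repeated rows.\<close>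

lemma rank_image_cols:
  fixes A B :: "real mat"
  assumes A: "A \<in> carrier_mat m n" and B: "B \<in> carrier_mat m' n'"
    and b: "\<And>k. k < m' \<Longrightarrow> b k < m" "\<And>i. i < m \<Longrightarrow> \<exists>k<m'. b k = i"
    and cols: "set (cols B) = (\<lambda>v. Matrix.vec m' (\<lambda>k. v $ b k)) ` set (cols A)"
  shows "vec_space.rank m' B = vec_space.rank m A"
proof -
  interpret A: vec_space "TYPE(real)" m .
  interpret B: vec_space "TYPE(real)" m' .
  define f :: "real vec \<Rightarrow> real vec" where "f v = Matrix.vec m' (\<lambda>k. v $ b k)" for v
  have Ac: "set (cols A) \<subseteq> carrier_vec m" using A cols_dim by blast
  have inj: "inj_on f (carrier_vec m)"
  proof (rule inj_onI)
    fix v w assume vw: "v \<in> carrier_vec m" "w \<in> carrier_vec m" "f v = f w"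
    show "v = w"
    proof (rule eq_vecI)
      fix i assume "i < dim_vec w"
      then obtain k where "k < m'" "b k = i" using b(2) vw by auto
      then show "v $ i = w $ i" using arg_cong[OF vw(3), of "\<lambda>u. u $ k"] by (simp add: f_def)
    qed (use vw in auto)
  qed
  have f0: "f v = 0\<^sub>v m' \<longleftrightarrow> v = 0\<^sub>v m" if "v \<in> carrier_vec m" for v
  proof -
    have "f (0\<^sub>v m) = 0\<^sub>v m'" using b(1) by (auto simp: f_def)
    then show ?thesis using inj that by (metis inj_onD zero_carrier_vec)
  qed
  have lc: "B.lincomb a (f ` S) = f (A.lincomb (a \<circ> f) S)" if S: "finite S" "S \<subseteq> carrier_vec m" for a S
  proof (rule eq_vecI)
    have fS: "f ` S \<subseteq> carrier_vec m'" by (auto simp: f_def)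
    have injS: "inj_on f S" using inj S inj_on_subset by blast
    show "dim_vec (B.lincomb a (f ` S)) = dim_vec (f (A.lincomb (a \<circ> f) S))"
      using fS S(1) B.lincomb_dim[of "f ` S" a] by (simp add: f_def)
    fix k assume "k < dim_vec (f (A.lincomb (a \<circ> f) S))"
    then have k: "k < m'" by (simp add: f_def)
    have "B.lincomb a (f ` S) $ k = (\<Sum>x\<in>S. a (f x) * f x $ k)"
      using B.lincomb_index[OF k fS] injS by (simp add: sum.reindex)
    also have "\<dots> = A.lincomb (a \<circ> f) S $ b k"
      using A.lincomb_index[OF b(1)[OF k] S(2)] k by (simp add: f_def)
    finally show "B.lincomb a (f ` S) $ k = f (A.lincomb (a \<circ> f) S) $ k" using k by (simp add: f_def)
  qed
  have li: "B.lin_indpt (f ` S) \<longleftrightarrow> A.lin_indpt S" if S: "finite S" "S \<subseteq> carrier_vec m" for S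
  proof
    have fS: "f ` S \<subseteq> carrier_vec m'" by (auto simp: f_def)
    assume L: "A.lin_indpt S"
    have "\<forall>v\<in>f ` S. a v = 0" if a: "B.lincomb a (f ` S) = 0\<^sub>v m'" for a
    proof -
      have "f (A.lincomb (a \<circ> f) S) = 0\<^sub>v m'" using lc[OF S] a by simp
      then have "A.lincomb (a \<circ> f) S = 0\<^sub>v m" using f0 S(2) A.lincomb_closed[OF S(2)] by auto
      then have "\<forall>v\<in>S. (a \<circ> f) v = 0"
        using A.lin_dep_crit[OF S(1) subset_refl, where a = "a \<circ> f"] L
        by (auto simp: class_ring_simps module_vec_simps)
      then show ?thesis by auto
    qed
    then show "B.lin_indpt (f ` S)"
      using S(1) fS by (intro B.finite_lin_indpt2) (auto simp: module_vec_simps)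
  next
    have injS: "inj_on f S" using inj S inj_on_subset by blast
    assume L: "B.lin_indpt (f ` S)"
    have "\<forall>v\<in>S. a v = 0" if a: "A.lincomb a S = 0\<^sub>v m" for a
    proof -
      define c where "c = a \<circ> the_inv_into S f"
      have cf: "c (f x) = a x" if "x \<in> S" for x
        using that injS by (simp add: c_def the_inv_into_f_f)
      have "A.lincomb (c \<circ> f) S = A.lincomb a S"
        using S by (intro A.lincomb_cong) (auto simp: cf module_vec_simps class_ring_simps)
      then have "B.lincomb c (f ` S) = f (0\<^sub>v m)"
        using lc[OF S] a by simp
      also have "\<dots> = 0\<^sub>v m'" using f0[of "0\<^sub>v m"] by simp
      finally have "\<forall>v\<in>f ` S. c v = 0"
        using B.lin_dep_crit[of "f ` S" "f ` S", where a = c] S L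
        by (auto simp: class_ring_simps module_vec_simps)
      then show ?thesis using cf by auto
    qed
    then show "A.lin_indpt S"
      using S by (intro A.finite_lin_indpt2) (auto simp: module_vec_simps)
  qed
  have colsB: "set (cols B) = f ` set (cols A)" unfolding cols f_def ..
  obtain S where S: "finite S" "maximal S (\<lambda>T. T \<subseteq> set (cols A) \<and> A.lin_indpt T)"
    using maximal_exists_superset[of "set (cols A)" "\<lambda>T. T \<subseteq> set (cols A) \<and> A.lin_indpt T" "{}"]
      A.finite_lin_indpt2[of "{}"] by auto
  have S': "S \<subseteq> set (cols A)" "A.lin_indpt S" using S(2) by (auto simp: maximal_def)
  have Smax: "T = S" if "S \<subseteq> T" "T \<subseteq> set (cols A)" "A.lin_indpt T" for T
    using S(2) that by (auto simp: maximal_def)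
  have Sc: "S \<subseteq> carrier_vec m" using S' Ac by auto
  have "maximal (f ` S) (\<lambda>T. T \<subseteq> set (cols B) \<and> B.lin_indpt T)"
    unfolding maximal_def
  proof (intro conjI allI impI)
    show "f ` S \<subseteq> set (cols B)" using S' colsB by auto
    show "B.lin_indpt (f ` S)" using li[OF S(1) Sc] S' by simp
    fix T assume T: "f ` S \<subseteq> T \<and> T \<subseteq> set (cols B) \<and> B.lin_indpt T"
    \<comment> \<open>The preimage of \<open>T\<close> among the columns of \<open>A\<close> is
      independent and contains \<open>S\<close>, so maximality of \<open>S\<close> gives
      \<open>R = S\<close>.\<close>
    define R where "R = {v \<in> set (cols A). f v \<in> T}"
    have fR: "f ` R = T" using T colsB by (auto simp: R_def)
    have R: "finite R" "R \<subseteq> carrier_vec m" using Ac by (auto simp: R_def)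
    have "R = S"
      using T S' fR li[OF R] by (intro Smax) (auto simp: R_def)
    then show "T = f ` S" using fR by simp
  qed
  then have "B.rank B = card (f ` S)" by (rule B.rank_card_indpt[OF B])
  also have "\<dots> = card S" using inj Sc by (intro card_image) (rule inj_on_subset)
  also have "\<dots> = A.rank A" using A.rank_card_indpt[OF A S(2)] by simp
  finally show ?thesis .
qed

lemma blown_up_carrier:
  assumes "P \<in> carrier_mat a b" "block_sizes a m \<mu>" "block_sizes b n \<nu>"
  shows "blown_up P \<mu> \<nu> \<in> carrier_mat m n"
  using assms by (auto simp: blown_up_def block_sizes_def)

text \<open>As a set, the columns of the blown up matrix are the stretched columns of
  \<open>P\<close>: each column index lies in some block, and each block is nonempty.\<close>

lemma rank_blown_up:
  assumes P: "P \<in> carrier_mat a b" and \<mu>: "block_sizes a m \<mu>" and \<nu>: "block_sizes b n \<nu>"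
  shows "vec_space.rank m (blown_up P \<mu> \<nu>) = vec_space.rank a P"
proof (rule rank_image_cols[OF P blown_up_carrier[OF assms]])
  let ?B = "blown_up P \<mu> \<nu>"
  let ?f = "\<lambda>v. Matrix.vec m (\<lambda>k. v $ block_of \<mu> k)"
  have m: "m = (\<Sum>i<a. \<mu> i)" and n: "n = (\<Sum>j<b. \<nu> j)" using \<mu> \<nu> by (auto simp: block_sizes_def)
  show less: "block_of \<mu> k < a" if "k < m" for k using that block_of_less m by auto
  show "\<exists>k<m. block_of \<mu> k = i" if "i < a" for i
    using block_of_surj[of \<mu> i a] \<mu> that m by (auto simp: block_sizes_def)
  have B: "?B \<in> carrier_mat m n" by (rule blown_up_carrier[OF assms])
  have colB: "col ?B l = ?f (col P (block_of \<nu> l))" if l: "l < n" for l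
  proof -
    have "block_of \<nu> l < b" using l block_of_less n by auto
    then show ?thesis using P B l less m n
      by (intro eq_vecI) (auto simp: blown_up_def)
  qed
  have "block_of \<nu> ` {..<n} = {..<b}"
    using block_of_surj[of \<nu> _ b] \<nu> block_of_less[of _ \<nu> b]
    unfolding block_sizes_def by (auto simp: image_iff)
  then have "(\<lambda>j. ?f (col P j)) ` {..<b} = (\<lambda>j. ?f (col P j)) ` block_of \<nu> ` {..<n}"
    by (simp only:)
  also have "\<dots> = (\<lambda>l. ?f (col P (block_of \<nu> l))) ` {..<n}" by (simp only: image_image)
  also have "\<dots> = col ?B ` {..<n}" using colB by (intro image_cong) auto
  also have "\<dots> = set (cols ?B)" using B by (auto simp: cols_def)
  finally show "set (cols ?B) = ?f ` set (cols P)"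
    using P by (auto simp: cols_def image_image lessThan_atLeast0)
qed

section \<open>Bilinear forms on lattice points\<close>

definition bform :: "nat \<Rightarrow> nat \<Rightarrow> (nat \<Rightarrow> nat \<Rightarrow> real) \<Rightarrow> (nat \<Rightarrow> real) \<Rightarrow> (nat \<Rightarrow> real) \<Rightarrow> real" where
  "bform m n w x y = (\<Sum>i<m. \<Sum>j<n. x i * w i j * y j)"

lemma bform_scale: "bform m n w (\<lambda>i. a * x i) (\<lambda>j. b * y j) = a * b * bform m n w x y"
  by (simp add: bform_def sum_distrib_left mult_ac)

lemma bform_decomp:
  "bform m n w x y = bform m n w x' y' + bform m n w x' (\<lambda>j. y j - y' j) + bform m n w (\<lambda>i. x i - x' i) y"
  unfolding bform_def sum.distrib[symmetric] by (intro sum.cong refl) (simp add: algebra_simps)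

text \<open>The integer vector \<open>p\<close> stands for the point
  \<open>p / (4 * sqrt m)\<close>, so the bound \<open>16 * int m\<close> says that this point lies
  in the unit ball. Extensional functions make the set finite.\<close>

definition lattice_ball :: "nat \<Rightarrow> (nat \<Rightarrow> int) set" where
  "lattice_ball m = {p \<in> {..<m} \<rightarrow>\<^sub>E UNIV. (\<Sum>i<m. (p i)\<^sup>2) \<le> 16 * int m}"

text \<open>Rounding towards zero shrinks every coordinate, so the lattice point stays in the ball.
  Each of the \<open>m\<close> coordinates is off by at most \<open>1 / (4 * sqrt m)\<close>, so the
  error vector has norm at most 1/4; multiplied by 4 it is again in the unit ball and can be rounded
  in turn.\<close>

lemma lattice_ball_approx:
  assumes x: "(\<Sum>i<m. (x i)\<^sup>2) \<le> (1::real)" and m: "0 < m"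
  obtains p where "p \<in> lattice_ball m"
    "(\<Sum>i<m. (p i / (4 * sqrt m))\<^sup>2) \<le> 1"
    "(\<Sum>i<m. (4 * (x i - p i / (4 * sqrt m)))\<^sup>2) \<le> 1"
proof -
  define r where "r = 4 * sqrt (real m)"
  have r: "0 < r" "r\<^sup>2 = 16 * real m" using m by (simp_all add: r_def power_mult_distrib)
  define p where "p = (\<lambda>i\<in>{..<m}. if 0 \<le> x i then \<lfloor>r * x i\<rfloor> else \<lceil>r * x i\<rceil>)"
  have p: "\<bar>real_of_int (p i)\<bar> \<le> \<bar>r * x i\<bar>" "\<bar>r * x i - p i\<bar> \<le> 1" if "i < m" for i
  proof -
    have "0 \<le> r * x i \<longleftrightarrow> 0 \<le> x i" using r by (simp add: zero_le_mult_iff)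
    then show "\<bar>real_of_int (p i)\<bar> \<le> \<bar>r * x i\<bar>" "\<bar>r * x i - p i\<bar> \<le> 1"
      using that r by (auto simp: p_def; linarith)+
  qed
  have "(\<Sum>i<m. (real_of_int (p i))\<^sup>2) \<le> (\<Sum>i<m. (r * x i)\<^sup>2)"
    using p(1) by (intro sum_mono) (simp add: abs_le_square_iff)
  also have "\<dots> = r\<^sup>2 * (\<Sum>i<m. (x i)\<^sup>2)" by (simp add: power_mult_distrib sum_distrib_left)
  also have "\<dots> \<le> r\<^sup>2" using x mult_left_mono[OF x, of "r\<^sup>2"] by simp
  finally have pr: "(\<Sum>i<m. (real_of_int (p i))\<^sup>2) \<le> r\<^sup>2" .
  then have "real_of_int (\<Sum>i<m. (p i)\<^sup>2) \<le> real_of_int (16 * int m)" unfolding r(2) by simp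
  then have 1: "p \<in> lattice_ball m" unfolding of_int_le_iff by (simp add: lattice_ball_def p_def)
  have "(\<Sum>i<m. (p i / r)\<^sup>2) = (\<Sum>i<m. (real_of_int (p i))\<^sup>2) / r\<^sup>2"
    by (simp add: power_divide sum_divide_distrib)
  then have 2: "(\<Sum>i<m. (p i / r)\<^sup>2) \<le> 1" using pr r(1) by simp
  have "(4 * (x i - p i / r))\<^sup>2 \<le> 1 / real m" if "i < m" for i
  proof -
    have "(r * (x i - p i / r))\<^sup>2 \<le> 1\<^sup>2"
      unfolding abs_le_square_iff[symmetric] using p(2)[OF that] r(1) by (simp add: right_diff_distrib)
    then show ?thesis using m unfolding power_mult_distrib r(2) by (simp add: field_simps)
  qed
  then have "(\<Sum>i<m. (4 * (x i - p i / r))\<^sup>2) \<le> (\<Sum>i<m. 1 / real m)" by (intro sum_mono) auto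
  then have "(\<Sum>i<m. (4 * (x i - p i / r))\<^sup>2) \<le> 1" using m by simp
  then show ?thesis using that 1 2 by (simp add: r_def)
qed

text \<open>Rounding both arguments leaves two error terms, each a quarter of a value of the form on
  the unit balls. A bound \<open>s\<close> for all such values therefore improves to
  \<open>t + s / 2\<close>, whose fixed point is \<open>2 * t\<close>. The iteration starts from the
  crude bound \<open>D\<close> and converges, so no supremum has to be attained.\<close>

lemma bform_le_of_lattice:
  assumes m: "0 < m" and n: "0 < n"
    and t: "\<And>p q. p \<in> lattice_ball m \<Longrightarrow> q \<in> lattice_ball n \<Longrightarrow>
      bform m n w (\<lambda>i. real_of_int (p i)) (\<lambda>j. real_of_int (q j)) \<le> 16 * sqrt m * sqrt n * t"
    and x: "(\<Sum>i<m. (x i)\<^sup>2) \<le> 1" and y: "(\<Sum>j<n. (y j)\<^sup>2) \<le> 1"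
  shows "bform m n w x y \<le> 2 * t"
proof -
  define D where "D = (\<Sum>i<m. \<Sum>j<n. \<bar>w i j\<bar>)"
  have t': "bform m n w (\<lambda>i. p i / (4 * sqrt m)) (\<lambda>j. q j / (4 * sqrt n)) \<le> t"
    if "p \<in> lattice_ball m" "q \<in> lattice_ball n" for p q
  proof -
    have "bform m n w (\<lambda>i. p i / (4 * sqrt m)) (\<lambda>j. q j / (4 * sqrt n)) =
      bform m n w (\<lambda>i. real_of_int (p i)) (\<lambda>j. real_of_int (q j)) / (16 * sqrt m * sqrt n)"
      using bform_scale[of m n w "1 / (4 * sqrt m)" p "1 / (4 * sqrt n)" q] by simp
    also have "\<dots> \<le> t" using t[OF that] m n by (simp add: field_simps)
    finally show ?thesis .
  qed
  \<comment> \<open>The zero vector is a lattice point, where the form vanishes.\<close>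
  have t0: "0 \<le> t"
  proof -
    have "(\<lambda>i\<in>{..<k}. 0) \<in> lattice_ball k" for k by (simp add: lattice_ball_def)
    from t'[OF this this] show ?thesis by (simp add: bform_def)
  qed
  have "bform m n w x y \<le> 2 * t + D / 2 ^ k" for k using x y
  proof (induction k arbitrary: x y)
    case 0
    have le1: "\<bar>z i\<bar> \<le> 1" if "(\<Sum>i<l. (z i)\<^sup>2) \<le> 1" "i < l" for z :: "nat \<Rightarrow> real" and i l
    proof -
      have "(z i)\<^sup>2 \<le> (\<Sum>i<l. (z i)\<^sup>2)" using that(2) by (intro member_le_sum) auto
      then have "(z i)\<^sup>2 \<le> 1" using that(1) by simp
      then show ?thesis by (simp add: abs_square_le_1)
    qed
    have "bform m n w x y \<le> D" unfolding bform_def D_def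
    proof (intro sum_mono)
      fix i j assume ij: "i \<in> {..<m}" "j \<in> {..<n}"
      have "\<bar>x i\<bar> * \<bar>w i j\<bar> * \<bar>y j\<bar> \<le> 1 * \<bar>w i j\<bar> * 1"
        using le1[OF 0(1), of i] le1[OF 0(2), of j] ij by (intro mult_mono) auto
      then have "\<bar>x i * w i j * y j\<bar> \<le> \<bar>w i j\<bar>" by (simp add: abs_mult)
      then show "x i * w i j * y j \<le> \<bar>w i j\<bar>" by linarith
    qed
    then show ?case using t0 by simp
  next
    case (Suc k)
    obtain p where p: "p \<in> lattice_ball m" "(\<Sum>i<m. (p i / (4 * sqrt m))\<^sup>2) \<le> 1"
      "(\<Sum>i<m. (4 * (x i - p i / (4 * sqrt m)))\<^sup>2) \<le> 1"
      using lattice_ball_approx[OF Suc.prems(1) m] by blast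
    obtain q where q: "q \<in> lattice_ball n" "(\<Sum>j<n. (q j / (4 * sqrt n))\<^sup>2) \<le> 1"
      "(\<Sum>j<n. (4 * (y j - q j / (4 * sqrt n)))\<^sup>2) \<le> 1"
      using lattice_ball_approx[OF Suc.prems(2) n] by blast
    let ?x = "\<lambda>i. p i / (4 * sqrt m)" and ?y = "\<lambda>j. q j / (4 * sqrt n)"
    have 1: "bform m n w ?x ?y \<le> t" using t' p q by blast
    have 2: "4 * bform m n w ?x (\<lambda>j. y j - ?y j) \<le> 2 * t + D / 2 ^ k"
      using Suc.IH[OF p(2) q(3)] bform_scale[of m n w 1 ?x 4 "\<lambda>j. y j - ?y j"] by simp
    have 3: "4 * bform m n w (\<lambda>i. x i - ?x i) y \<le> 2 * t + D / 2 ^ k"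
      using Suc.IH[OF p(3) Suc.prems(2)] bform_scale[of m n w 4 "\<lambda>i. x i - ?x i" 1 y] by simp
    have "D / 2 ^ Suc k = (D / 2 ^ k) / 2" by simp
    then show ?case using bform_decomp[of m n w x y ?x ?y] 1 2 3 by linarith
  qed
  moreover have "(\<lambda>k. 2 * t + D / 2 ^ k) \<longlonglongrightarrow> 2 * t + 0"
    by (intro tendsto_intros LIMSEQ_divide_realpow_zero) auto
  ultimately show ?thesis by (intro LIMSEQ_le_const[of "\<lambda>k. 2 * t + D / 2 ^ k"]) auto
qed

text \<open>A two-sided geometric series with total 1 + 2 = 3, the origin of the factor 3 per
  coordinate in the lattice count.\<close>

lemma sum_half_power_abs: "(\<Sum>k\<in>{- int N..int N}. (1/2::real) ^ nat \<bar>k\<bar>) = 3 - 2 * (1/2) ^ N"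
proof (induction N)
  case (Suc N)
  have "{- int (Suc N)..int (Suc N)} = insert (- int (Suc N)) (insert (int (Suc N)) {- int N..int N})"
    by auto
  then show ?case using Suc by (simp add: nat_add_distrib)
qed simp

text \<open>An exponential-weight count. Integers satisfy
  \<open>\<bar>z\<bar> \<le> z\<^sup>2\<close>, so a member of the ball has sum of absolute values
  at most \<open>16 * m\<close>. Hence the factor \<open>2 ^ 16\<close> per coordinate outweighs the
  decay \<open>(1/2) ^ nat \<bar>k\<bar>\<close> in total.\<close>

lemma card_lattice_ball: "finite (lattice_ball m)" "real (card (lattice_ball m)) \<le> (2 ^ 16 * 3) ^ m"
proof -
  let ?C = "\<lambda>_::nat. {- int (16 * m)..int (16 * m)}"
  let ?E = "PiE {..<m} ?C"
  have abs_le: "\<bar>z\<bar> \<le> z\<^sup>2" for z :: int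
    using self_le_power[of "\<bar>z\<bar>" 2] by (cases "z = 0") auto
  have sub: "lattice_ball m \<subseteq> ?E"
  proof
    fix p assume p: "p \<in> lattice_ball m"
    have "p i \<in> ?C i" if "i < m" for i
    proof -
      have "(p i)\<^sup>2 \<le> (\<Sum>i<m. (p i)\<^sup>2)" using that by (intro member_le_sum) auto
      then have "\<bar>p i\<bar> \<le> 16 * int m" using p abs_le[of "p i"] by (simp add: lattice_ball_def)
      then show ?thesis by auto
    qed
    then show "p \<in> ?E" using p by (auto simp: lattice_ball_def PiE_iff)
  qed
  have finE: "finite ?E" by (intro finite_PiE) auto
  then show "finite (lattice_ball m)" using sub finite_subset by blast
  \<comment> \<open>The product weight \<open>?g\<close> is at least 1 on \<open>lattice_ball m\<close>, and its sum over a box factorises.\<close>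
  let ?g = "\<lambda>k::int. 2 ^ 16 * (1/2::real) ^ nat \<bar>k\<bar>"
  have ge1: "1 \<le> (\<Prod>i<m. ?g (p i))" if p: "p \<in> lattice_ball m" for p
  proof -
    have "int (\<Sum>i<m. nat \<bar>p i\<bar>) \<le> (\<Sum>i<m. (p i)\<^sup>2)"
      unfolding of_nat_sum using abs_le by (intro sum_mono) auto
    also have "\<dots> \<le> int (16 * m)" using p by (simp add: lattice_ball_def)
    finally have "(\<Sum>i<m. nat \<bar>p i\<bar>) \<le> 16 * m" by (simp only: of_nat_le_iff)
    then have "(1/2::real) ^ (16 * m) \<le> (1/2) ^ (\<Sum>i<m. nat \<bar>p i\<bar>)"
      by (intro power_decreasing) auto
    moreover have "(\<Prod>i<m. ?g (p i)) = (2 ^ 16) ^ m * (1/2) ^ (\<Sum>i<m. nat \<bar>p i\<bar>)"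
      by (simp add: prod.distrib power_sum)
    moreover have "(2 ^ 16 :: real) ^ m * (1/2) ^ (16 * m) = 1"
      unfolding power_mult power_mult_distrib[symmetric] by simp
    ultimately show ?thesis
      by (metis mult_left_mono zero_le_numeral zero_le_power)
  qed
  have "real (card (lattice_ball m)) = (\<Sum>p\<in>lattice_ball m. 1)" by simp
  also have "\<dots> \<le> (\<Sum>p\<in>lattice_ball m. \<Prod>i<m. ?g (p i))" using ge1 by (intro sum_mono)
  also have "\<dots> \<le> (\<Sum>p\<in>?E. \<Prod>i<m. ?g (p i))"
    using finE sub by (intro sum_mono2) (auto intro!: mult_nonneg_nonneg prod_nonneg)
  also have "\<dots> = (\<Prod>i<m. \<Sum>k\<in>?C i. ?g k)" by (subst prod_sum_PiE) auto
  also have "\<dots> = (2 ^ 16 * (3 - 2 * (1/2) ^ (16 * m))) ^ m"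
    unfolding sum_distrib_left[symmetric] sum_half_power_abs by simp
  also have "\<dots> \<le> (2 ^ 16 * 3) ^ m"
  proof (intro power_mono mult_left_mono)
    have "(1/2::real) ^ (16 * m) \<le> 1" by (intro power_le_one) auto
    then show "(0::real) \<le> 2 ^ 16 * (3 - 2 * (1/2) ^ (16 * m))" by simp
  qed auto
  finally show "real (card (lattice_ball m)) \<le> (2 ^ 16 * 3) ^ m" .
qed

section \<open>Norm of Wigner noise\<close>

text \<open>Hoeffding's inequality for the independent summands
  \<open>c ij * W \<omega> $$ ij\<close>, which lie in intervals of half-width
  \<open>K * \<bar>c ij\<bar>\<close>. The squared widths add up to at most
  \<open>4 * K\<^sup>2 * (16 * m) * (16 * n)\<close>; the factor \<open>16 * sqrt m * sqrt n\<close>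
  in the threshold is the product of the two lattice scales and cancels against this.\<close>

lemma wigner_bform_tail:
  fixes W :: "'w \<Rightarrow> real mat" and p q :: "nat \<Rightarrow> int"
  assumes M: "prob_space M" and W: "wigner_noise M K m n W" and K: "0 < K"
    and m: "0 < m" and n: "0 < n" and s: "0 < s"
    and p: "p \<in> lattice_ball m" and q: "q \<in> lattice_ball n"
  defines "T \<equiv> {\<omega>\<in>space M. 16 * sqrt m * sqrt n * s \<le>
    bform m n (\<lambda>i j. W \<omega> $$ (i, j)) (\<lambda>i. real_of_int (p i)) (\<lambda>j. real_of_int (q j))}"
  shows "T \<in> sets M" "measure M T \<le> exp (- (s\<^sup>2 / (2 * K\<^sup>2)))"
proof -
  interpret prob_space M by fact
  define I where "I = {..<m} \<times> {..<n}"
  define c where "c = (\<lambda>(i, j). real_of_int (p i) * real_of_int (q j))"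
  define X where "X = (\<lambda>ij \<omega>. c ij * W \<omega> $$ ij)"
  have indW: "indep_vars (\<lambda>_. borel) (\<lambda>(i, j) \<omega>. W \<omega> $$ (i, j)) I"
    using W by (simp add: wigner_noise_def I_def)
  have indW': "indep_vars (\<lambda>_. borel) (\<lambda>ij \<omega>. W \<omega> $$ ij) I"
    using indW by (simp add: case_prod_unfold)
  have indep: "indep_vars (\<lambda>_. borel) X I"
    unfolding X_def by (rule indep_vars_compose2[OF indW', where Y = "\<lambda>ij x. c ij * x"]) simp
  interpret Hoeffding_ineq M I X "\<lambda>ij. - (K * \<bar>c ij\<bar>)" "\<lambda>ij. K * \<bar>c ij\<bar>" "\<Sum>ij\<in>I. expectation (X ij)"
  proof unfold_locales
    fix ij assume "ij \<in> I"
    then have "AE \<omega> in M. \<bar>W \<omega> $$ ij\<bar> \<le> K" using W by (auto simp: wigner_noise_def I_def)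
    then show "AE \<omega> in M. X ij \<omega> \<in> {- (K * \<bar>c ij\<bar>)..K * \<bar>c ij\<bar>}"
    proof eventually_elim
      case (elim \<omega>)
      then have "\<bar>X ij \<omega>\<bar> \<le> K * \<bar>c ij\<bar>"
        using mult_right_mono[of "\<bar>W \<omega> $$ ij\<bar>" K "\<bar>c ij\<bar>"]
        by (simp add: X_def abs_mult mult.commute)
      then show ?case by (auto simp: abs_le_iff)
    qed
  qed (use indep in \<open>auto simp: I_def\<close>)
  have "expectation (X ij) = 0" if "ij \<in> I" for ij
    using that W by (auto simp: X_def wigner_noise_def I_def)
  then have mean: "(\<Sum>ij\<in>I. expectation (X ij)) = 0" by simp
  let ?e = "16 * sqrt m * sqrt n * s"
  have form: "bform m n (\<lambda>i j. W \<omega> $$ (i, j)) (\<lambda>i. real_of_int (p i)) (\<lambda>j. real_of_int (q j))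
    = (\<Sum>ij\<in>I. X ij \<omega>)" for \<omega>
    unfolding bform_def I_def sum.cartesian_product X_def c_def
    by (intro sum.cong) (auto simp: mult_ac)
  have T: "T = {\<omega>\<in>space M. (\<Sum>ij\<in>I. X ij \<omega>) \<ge> 0 + ?e}" unfolding T_def form by simp
  have [measurable]: "X ij \<in> borel_measurable M" if "ij \<in> I" for ij
    using random_variable that by auto
  show "T \<in> sets M" unfolding T by measurable
  let ?V = "\<Sum>ij\<in>I. (K * \<bar>c ij\<bar> - - (K * \<bar>c ij\<bar>))\<^sup>2"
  have e: "0 < ?e" using m n s by simp
  have "?V = (\<Sum>i<m. \<Sum>j<n. 4 * K\<^sup>2 * ((real_of_int (p i))\<^sup>2 * (real_of_int (q j))\<^sup>2))"
    unfolding I_def sum.cartesian_product c_def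
    by (intro sum.cong) (auto simp: power_mult_distrib)
  also have "\<dots> = 4 * K\<^sup>2 * ((\<Sum>i<m. (real_of_int (p i))\<^sup>2) * (\<Sum>j<n. (real_of_int (q j))\<^sup>2))"
    by (subst sum_product) (simp add: sum_distrib_left)
  also have "\<dots> = 4 * K\<^sup>2 * (real_of_int (\<Sum>i<m. (p i)\<^sup>2) * real_of_int (\<Sum>j<n. (q j)\<^sup>2))" by simp
  also have "\<dots> \<le> 4 * K\<^sup>2 * ((16 * real m) * (16 * real n))"
  proof -
    have "real_of_int (\<Sum>i<m. (p i)\<^sup>2) \<le> real_of_int (16 * int m)"
      using p unfolding of_int_le_iff by (simp add: lattice_ball_def)
    moreover have "real_of_int (\<Sum>j<n. (q j)\<^sup>2) \<le> real_of_int (16 * int n)"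
      using q unfolding of_int_le_iff by (simp add: lattice_ball_def)
    ultimately have "real_of_int (\<Sum>i<m. (p i)\<^sup>2) * real_of_int (\<Sum>j<n. (q j)\<^sup>2)
      \<le> (16 * real m) * (16 * real n)"
      by (intro mult_mono) (auto intro!: sum_nonneg)
    then show ?thesis by (intro mult_left_mono) auto
  qed
  finally have V: "?V \<le> 4 * K\<^sup>2 * ((16 * real m) * (16 * real n))" .
  show "measure M T \<le> exp (- (s\<^sup>2 / (2 * K\<^sup>2)))"
  proof (cases "0 < ?V")
    case True
    have "measure M T \<le> exp (- 2 * ?e\<^sup>2 / ?V)"
      using Hoeffding_ineq_ge[of ?e] e True unfolding T mean by simp
    also have "\<dots> \<le> exp (- (s\<^sup>2 / (2 * K\<^sup>2)))"
    proof -
      have "s\<^sup>2 / (2 * K\<^sup>2) = 2 * ?e\<^sup>2 / (4 * K\<^sup>2 * ((16 * real m) * (16 * real n)))"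
        using m n K by (simp add: power_mult_distrib field_simps)
      also have "\<dots> \<le> 2 * ?e\<^sup>2 / ?V"
        using V True by (intro divide_left_mono) (auto intro!: mult_pos_pos simp: m n K)
      finally show ?thesis by simp
    qed
    finally show ?thesis .
  next
    \<comment> \<open>Hoeffding's inequality is applied only with positive total width. Otherwise
      all coefficients vanish, as when \<open>p\<close> or \<open>q\<close> is zero; the form is
      then identically 0 and stays below the positive threshold.\<close>
    case False
    have "(K * \<bar>c ij\<bar> - - (K * \<bar>c ij\<bar>))\<^sup>2 = 0" if "ij \<in> I" for ij
    proof -
      have "?V = 0" using False sum_nonneg[of I "\<lambda>ij. (K * \<bar>c ij\<bar> - - (K * \<bar>c ij\<bar>))\<^sup>2"] by simp
      then show ?thesis using that by (subst (asm) sum_nonneg_eq_0_iff) (auto simp: I_def)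
    qed
    then have "X ij \<omega> = 0" if "ij \<in> I" for ij \<omega> using that K by (simp add: X_def)
    then have "T = {}" using e unfolding T by simp
    then show ?thesis by simp
  qed
qed

text \<open>The exceptional event off which the lattice bound holds with
  \<open>t = 8 * K * sqrt (m + n)\<close>. It is one-sided because replacing \<open>p\<close> by its
  negative turns the lower tail into the upper one.\<close>

definition large_form :: "'w measure \<Rightarrow> real \<Rightarrow> nat \<Rightarrow> nat \<Rightarrow> ('w \<Rightarrow> real mat) \<Rightarrow> 'w set" where
  "large_form M K m n W = {\<omega>\<in>space M. \<exists>p\<in>lattice_ball m. \<exists>q\<in>lattice_ball n.
     16 * sqrt m * sqrt n * (8 * K * sqrt (m + n)) \<le>
       bform m n (\<lambda>i j. W \<omega> $$ (i, j)) (\<lambda>i. real_of_int (p i)) (\<lambda>j. real_of_int (q j))}"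

lemma large_form_prob:
  fixes W :: "'w \<Rightarrow> real mat"
  assumes M: "prob_space M" and W: "wigner_noise M K m n W" and K: "0 < K"
    and m: "0 < m" and n: "0 < n"
  shows "large_form M K m n W \<in> sets M" "measure M (large_form M K m n W) \<le> (1/4) ^ (m + n)"
proof -
  interpret prob_space M by fact
  let ?s = "8 * K * sqrt (m + n)"
  define T where "T = (\<lambda>(p, q). {\<omega>\<in>space M. 16 * sqrt m * sqrt n * ?s \<le>
    bform m n (\<lambda>i j. W \<omega> $$ (i, j)) (\<lambda>i. real_of_int (p i)) (\<lambda>j. real_of_int (q j))})"
  let ?L = "lattice_ball m \<times> lattice_ball n"
  have s: "0 < ?s" using K m by simp
  have eq: "large_form M K m n W = (\<Union>pq\<in>?L. T pq)" by (auto simp: large_form_def T_def)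
  have finL: "finite ?L" using card_lattice_ball(1) by auto
  have Ts: "T pq \<in> sets M" "measure M (T pq) \<le> exp (- 32) ^ (m + n)" if pqL: "pq \<in> ?L" for pq
  proof -
    obtain p q where pq: "pq = (p, q)" "p \<in> lattice_ball m" "q \<in> lattice_ball n" using pqL by auto
    note * = wigner_bform_tail[OF M W K m n s pq(2,3)]
    show "T pq \<in> sets M" unfolding T_def pq(1) prod.case by (rule *(1))
    have "?s\<^sup>2 / (2 * K\<^sup>2) = 32 * real (m + n)" using K by (simp add: power_mult_distrib field_simps)
    then have "exp (- (?s\<^sup>2 / (2 * K\<^sup>2))) = exp (- 32) ^ (m + n)"
      by (simp add: exp_of_nat_mult[symmetric] mult.commute)
    then show "measure M (T pq) \<le> exp (- 32) ^ (m + n)"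
      using *(2) unfolding T_def pq(1) prod.case by (simp only:)
  qed
  show "large_form M K m n W \<in> sets M" unfolding eq using finL Ts by (intro sets.finite_UN) auto
  have "measure M (large_form M K m n W) \<le> (\<Sum>pq\<in>?L. measure M (T pq))"
    unfolding eq using finL Ts by (intro finite_measure_subadditive_finite) auto
  also have "\<dots> \<le> (\<Sum>pq\<in>?L. exp (- 32) ^ (m + n))" using Ts by (intro sum_mono) auto
  also have "\<dots> = real (card (lattice_ball m)) * real (card (lattice_ball n)) * exp (- 32) ^ (m + n)"
    by (simp add: card_cartesian_product)
  also have "\<dots> \<le> (2 ^ 16 * 3) ^ m * (2 ^ 16 * 3) ^ n * exp (- 32) ^ (m + n)"
    by (intro mult_mono card_lattice_ball) auto
  also have "\<dots> = (2 ^ 16 * 3 * exp (- 32)) ^ (m + n)"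
    by (simp add: power_add power_mult_distrib)
  also have "\<dots> \<le> (1/4) ^ (m + n)"
  proof (intro power_mono)
    \<comment> \<open>From \<open>exp 1 \<ge> 2\<close> the base is at most 3 * 2^(-16), well below
      1/4.\<close>
    have "(2::real) ^ 32 \<le> exp 1 ^ 32" using exp_ge_add_one_self[of 1] by (intro power_mono) auto
    also have "\<dots> = exp 32" by (simp flip: exp_of_nat_mult)
    finally show "2 ^ 16 * 3 * exp (- 32) \<le> (1/4::real)" by (simp add: exp_minus field_simps)
  qed auto
  finally show "measure M (large_form M K m n W) \<le> (1/4) ^ (m + n)" .
qed

text \<open>Grouping by \<open>k = m + n\<close> turns the double index into one sequence. A pair is
  determined by its first component, so there are at most \<open>k \<le> 2 ^ k\<close> pairs in a
  group, and its union has probability at most 2^k * 4^(-k) = 2^(-k).\<close>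

lemma wigner_large_form_finitely_often:
  fixes W :: "nat \<Rightarrow> nat \<Rightarrow> 'w \<Rightarrow> real mat"
  assumes M: "prob_space M" and W: "\<And>m n. wigner_noise M K m n (W m n)" and K: "0 < K"
  shows "AE \<omega> in M. \<exists>k0. \<forall>m n. 0 < m \<longrightarrow> 0 < n \<longrightarrow> k0 \<le> m + n \<longrightarrow> \<omega> \<notin> large_form M K m n (W m n)"
proof -
  interpret prob_space M by fact
  define I where "I k = {(m, n). 0 < m \<and> 0 < n \<and> m + n = k}" for k :: nat
  define E where "E k = (\<Union>(m, n)\<in>I k. large_form M K m n (W m n))" for k
  have I_sub: "I k \<subseteq> (\<lambda>m. (m, k - m)) ` {..<k}" for k by (auto simp: I_def image_iff)
  have finI: "finite (I k)" for k using I_sub finite_subset by blast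
  have cardI: "card (I k) \<le> k" for k
    using card_mono[OF _ I_sub[of k]] card_image_le[of "{..<k}" "\<lambda>m. (m, k - m)"] by fastforce
  have E: "E k \<in> sets M" for k
    unfolding E_def using finI large_form_prob(1)[OF M W K]
    by (intro sets.finite_UN) (auto simp: I_def)
  have bound: "measure M (E k) \<le> (1/2) ^ k" for k
  proof -
    have "measure M (E k) \<le> (\<Sum>mn\<in>I k. measure M (case mn of (m, n) \<Rightarrow> large_form M K m n (W m n)))"
      unfolding E_def using finI large_form_prob(1)[OF M W K]
      by (intro finite_measure_subadditive_finite) (auto simp: I_def)
    also have "\<dots> \<le> (\<Sum>mn\<in>I k. (1/4) ^ k)"
      using large_form_prob(2)[OF M W K] by (intro sum_mono) (auto simp: I_def)
    also have "\<dots> = real (card (I k)) * (1/4) ^ k" by simp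
    also have "\<dots> \<le> 2 ^ k * (1/4) ^ k"
    proof (intro mult_right_mono)
      have "real (card (I k)) \<le> real k" using cardI by simp
      also have "\<dots> \<le> 2 ^ k" using less_exp[of k] by (metis less_imp_le of_nat_le_iff of_nat_numeral of_nat_power)
      finally show "real (card (I k)) \<le> 2 ^ k" .
    qed simp
    also have "\<dots> = (1/2) ^ k" by (simp flip: power_mult_distrib)
    finally show ?thesis .
  qed
  have "summable (\<lambda>k. measure M (E k))"
    using bound by (intro summable_comparison_test[OF _ summable_geometric[of "1/2"]]) auto
  then have "AE \<omega> in M. eventually (\<lambda>k. \<omega> \<in> space M - E k) sequentially"
    using E by (intro borel_cantelli_AE1) (auto simp: emeasure_eq_measure)
  then show ?thesis
  proof eventually_elim
    case (elim \<omega>)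
    then obtain k0 where "\<And>k. k0 \<le> k \<Longrightarrow> \<omega> \<notin> E k" by (auto simp: eventually_sequentially)
    moreover have "large_form M K m n (W m n) \<subseteq> E (m + n)" if "0 < m" "0 < n" for m n
      using that by (force simp: E_def I_def)
    ultimately show ?case by (intro exI[of _ k0]) blast
  qed
qed

section \<open>From bilinear forms to the operator norm of the noise\<close>

lemma vnorm_eq_L2_set: "vnorm v = L2_set (\<lambda>i. v $ i) {..<dim_vec v}"
  by (simp add: vnorm_def L2_set_def scalar_prod_def power2_eq_square lessThan_atLeast0)

lemma vnorm_triangle:
  assumes "u \<in> carrier_vec n" "v \<in> carrier_vec n"
  shows "vnorm (u + v) \<le> vnorm u + vnorm v"
proof -
  have "vnorm (u + v) = L2_set (\<lambda>i. u $ i + v $ i) {..<n}"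
    unfolding vnorm_eq_L2_set using assms by (intro L2_set_cong) auto
  then show ?thesis using L2_set_triangle_ineq[of "\<lambda>i. u $ i" "\<lambda>i. v $ i" "{..<n}"] assms
    by (simp add: vnorm_eq_L2_set)
qed

lemma scalar_prod_mult_mat_vec:
  assumes "A \<in> carrier_mat m n" "x \<in> carrier_vec n" "y \<in> carrier_vec m"
  shows "y \<bullet> (A *\<^sub>v x) = bform m n (\<lambda>i j. A $$ (i, j)) (\<lambda>i. y $ i) (\<lambda>j. x $ j)"
  using assms
  by (auto simp: bform_def scalar_prod_def sum_distrib_left mult_ac lessThan_atLeast0 intro!: sum.cong)

text \<open>Duality: for \<open>u = A *\<^sub>v x\<close> the form at \<open>u\<close> and
  \<open>x\<close> equals the squared norm of \<open>u\<close>, so at the two normalised vectors it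
  equals \<open>vnorm u / vnorm x\<close>.\<close>

lemma vnorm_mult_le:
  assumes A: "A \<in> carrier_mat m n" and x: "x \<in> carrier_vec n"
    and t: "\<And>x y. (\<Sum>i<m. (x i)\<^sup>2) \<le> 1 \<Longrightarrow> (\<Sum>j<n. (y j)\<^sup>2) \<le> 1 \<Longrightarrow>
      bform m n (\<lambda>i j. A $$ (i, j)) x y \<le> t"
  shows "vnorm (A *\<^sub>v x) \<le> t * vnorm x"
proof -
  define u where "u = A *\<^sub>v x"
  have u: "u \<in> carrier_vec m" using A x by (simp add: u_def)
  have sq: "(\<Sum>i<k. (v $ i)\<^sup>2) = (vnorm v)\<^sup>2" if "v \<in> carrier_vec k" for v k
    using that by (simp add: vnorm_eq_L2_set L2_set_def sum_nonneg)
  have nn: "0 \<le> vnorm v" for v by (simp add: vnorm_eq_L2_set)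
  have t0: "0 \<le> t" using t[of "\<lambda>_. 0" "\<lambda>_. 0"] by (simp add: bform_def)
  have uu: "(vnorm u)\<^sup>2 = bform m n (\<lambda>i j. A $$ (i, j)) (\<lambda>i. u $ i) (\<lambda>j. x $ j)"
    using scalar_prod_mult_mat_vec[OF A x u] scalar_prod_ge_0_real[of u]
    by (simp add: vnorm_def flip: u_def)
  show ?thesis
  proof (cases "vnorm u = 0 \<or> vnorm x = 0")
    case True
    moreover have "vnorm u = 0" if "vnorm x = 0"
    proof -
      have "x = 0\<^sub>v n"
        using that x by (intro eq_vecI) (auto simp: vnorm_eq_L2_set L2_set_eq_0_iff)
      then have "u = 0\<^sub>v m" using A by (auto simp: u_def)
      then show ?thesis by (simp add: vnorm_def)
    qed
    ultimately have "vnorm u = 0" by blast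
    then show ?thesis using t0 nn[of x] by (simp add: u_def)
  next
    case False
    then have pos: "0 < vnorm u" "0 < vnorm x" using nn[of u] nn[of x] by auto
    have unit: "(\<Sum>i<k. (1 / vnorm v * v $ i)\<^sup>2) \<le> 1" if "v \<in> carrier_vec k" "0 < vnorm v" for v k
    proof -
      have "(\<Sum>i<k. (1 / vnorm v * v $ i)\<^sup>2) = (\<Sum>i<k. (v $ i)\<^sup>2) / (vnorm v)\<^sup>2"
        by (simp add: power_divide sum_divide_distrib)
      then show ?thesis using that by (simp add: sq)
    qed
    have "(vnorm u)\<^sup>2 / (vnorm u * vnorm x) \<le> t"
      using t[OF unit[OF u pos(1)] unit[OF x pos(2)]] unfolding bform_scale uu by simp
    then show ?thesis using pos by (simp add: field_simps power2_eq_square u_def)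
  qed
qed

lemma wigner_norm_bound:
  fixes W :: "nat \<Rightarrow> nat \<Rightarrow> 'w \<Rightarrow> real mat"
  assumes M: "prob_space M" and W: "\<And>m n. wigner_noise M K m n (W m n)" and K: "0 < K"
  shows "AE \<omega> in M. \<exists>k0. \<forall>m n. 0 < m \<longrightarrow> 0 < n \<longrightarrow> k0 \<le> m + n \<longrightarrow>
    (\<forall>x\<in>carrier_vec n. vnorm (W m n \<omega> *\<^sub>v x) \<le> 16 * K * sqrt (real (m + n)) * vnorm x)"
  \<comment> \<open>\<open>AE_space\<close> supplies \<open>\<omega> \<in> space M\<close>: the
    dimensions of the matrix are known only there, and \<open>large_form\<close> contains only such
    points.\<close>
  using wigner_large_form_finitely_often[OF assms] AE_space
proof eventually_elim
  case (elim \<omega>)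
  then obtain k0 where k0: "\<And>m n. 0 < m \<Longrightarrow> 0 < n \<Longrightarrow> k0 \<le> m + n \<Longrightarrow> \<omega> \<notin> large_form M K m n (W m n)"
    by blast
  have "vnorm (W m n \<omega> *\<^sub>v x) \<le> 16 * K * sqrt (real (m + n)) * vnorm x"
    if mn: "0 < m" "0 < n" "k0 \<le> m + n" and x: "x \<in> carrier_vec n" for m n x
  proof (rule vnorm_mult_le[OF _ x])
    show "W m n \<omega> \<in> carrier_mat m n" using W elim by (auto simp: wigner_noise_def)
    fix y z :: "nat \<Rightarrow> real"
    assume yz: "(\<Sum>i<m. (y i)\<^sup>2) \<le> 1" "(\<Sum>j<n. (z j)\<^sup>2) \<le> 1"
    have "bform m n (\<lambda>i j. W m n \<omega> $$ (i, j)) y z \<le> 2 * (8 * K * sqrt (real (m + n)))"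
    proof (rule bform_le_of_lattice[OF mn(1,2) _ yz])
      fix p q assume pq: "p \<in> lattice_ball m" "q \<in> lattice_ball n"
      let ?b = "bform m n (\<lambda>i j. W m n \<omega> $$ (i, j)) (\<lambda>i. real_of_int (p i)) (\<lambda>j. real_of_int (q j))"
      let ?T = "16 * sqrt m * sqrt n * (8 * K * sqrt (real (m + n)))"
      have "\<omega> \<in> large_form M K m n (W m n)" if "?T \<le> ?b"
        unfolding large_form_def using elim(2) pq that by blast
      then show "?b \<le> ?T" using k0[OF mn] by linarith
    qed
    then show "bform m n (\<lambda>i j. W m n \<omega> $$ (i, j)) y z \<le> 16 * K * sqrt (real (m + n))" by simp
  qed
  then show ?case by blast
qed

theorem theorem9:
  fixes M :: "'w measure"
    and P :: "real mat"
    and W :: "nat \<Rightarrow> nat \<Rightarrow> 'w \<Rightarrow> real mat"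
    and \<mu> \<nu> :: "nat \<Rightarrow> nat \<Rightarrow> nat \<Rightarrow> nat"
    and a b :: nat and K c d :: real
  assumes "prob_space M"
    and "0 < a" and "0 < b"
    and "P \<in> carrier_mat a b"
    and "\<And>i j. i < a \<Longrightarrow> j < b \<Longrightarrow> 0 \<le> P $$ (i, j) \<and> P $$ (i, j) \<le> 1"
    and "0 < K"
    and "\<And>m n. wigner_noise M K m n (W m n)"
    and "0 < c" and "c < 1" and "0 < d" and "d < 1"
  shows "(\<forall>m n. block_sizes a m (\<mu> m n) \<longrightarrow> block_sizes b n (\<nu> m n) \<longrightarrow>
           vec_space.rank m (blown_up P (\<mu> m n) (\<nu> m n)) = vec_space.rank a P \<and>
           length (filter (\<lambda>s. 0 < s) (singular_values (blown_up P (\<mu> m n) (\<nu> m n)))) =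
             vec_space.rank a P) \<and>
         (\<exists>C. almost_surely M (\<lambda>m n \<omega>.
           block_sizes a m (\<mu> m n) \<longrightarrow> block_sizes b n (\<nu> m n) \<longrightarrow>
           GC1 c d a b m n (\<mu> m n) (\<nu> m n) \<longrightarrow>
           (let B = blown_up P (\<mu> m n) (\<nu> m n); A = B + W m n \<omega>;
                s = singular_values B; r = vec_space.rank a P
            in \<exists>z. mset z = mset (singular_values A) \<and>
                 (\<forall>i<r. \<bar>z ! i - s ! i\<bar> \<le> C * sqrt (real (m + n))) \<and>
                 (\<forall>j. r \<le> j \<and> j < min m n \<longrightarrow> z ! j \<le> C * sqrt (real (m + n))))))"
proof (intro conjI allI impI exI)
  note P = \<open>P \<in> carrier_mat a b\<close> and W = \<open>\<And>m n. wigner_noise M K m n (W m n)\<close>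
  show rank: "vec_space.rank m (blown_up P (\<mu> m n) (\<nu> m n)) = vec_space.rank a P"
    if "block_sizes a m (\<mu> m n)" "block_sizes b n (\<nu> m n)" for m n
    using rank_blown_up[OF P that] .
  show "length (filter (\<lambda>s. 0 < s) (singular_values (blown_up P (\<mu> m n) (\<nu> m n)))) = vec_space.rank a P"
    if "block_sizes a m (\<mu> m n)" "block_sizes b n (\<nu> m n)" for m n
    using singular_values_rank(1)[OF blown_up_carrier[OF P that]] rank[OF that] by simp
  \<comment> \<open>The witness \<open>16 * K\<close> for \<open>C\<close> is deterministic and
    independent of the sizes; only the threshold \<open>k0\<close> below depends on
    \<open>\<omega>\<close>.\<close>
  show "almost_surely M (\<lambda>m n \<omega>.
           block_sizes a m (\<mu> m n) \<longrightarrow> block_sizes b n (\<nu> m n) \<longrightarrow>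
           GC1 c d a b m n (\<mu> m n) (\<nu> m n) \<longrightarrow>
           (let B = blown_up P (\<mu> m n) (\<nu> m n); A = B + W m n \<omega>;
                s = singular_values B; r = vec_space.rank a P
            in \<exists>z. mset z = mset (singular_values A) \<and>
                 (\<forall>i<r. \<bar>z ! i - s ! i\<bar> \<le> 16 * K * sqrt (real (m + n))) \<and>
                 (\<forall>j. r \<le> j \<and> j < min m n \<longrightarrow> z ! j \<le> 16 * K * sqrt (real (m + n)))))"
    unfolding almost_surely_def
    using wigner_norm_bound[OF \<open>prob_space M\<close> W \<open>0 < K\<close>] AE_space
  proof eventually_elim
    case (elim \<omega>)
    then obtain k0 where k0: "\<And>m n x. 0 < m \<Longrightarrow> 0 < n \<Longrightarrow> k0 \<le> m + n \<Longrightarrow> x \<in> carrier_vec n \<Longrightarrow>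
      vnorm (W m n \<omega> *\<^sub>v x) \<le> 16 * K * sqrt (real (m + n)) * vnorm x"
      by blast
    show ?case unfolding Let_def
    \<comment> \<open>The 1 excludes empty matrices, and \<open>k0 \<le> m\<close> already gives
      \<open>k0 \<le> m + n\<close>.\<close>
    proof (intro exI[of _ "max 1 k0"] allI impI)
      fix m n assume m: "max 1 k0 \<le> m" and n: "max 1 k0 \<le> n"
        and sizes: "block_sizes a m (\<mu> m n)" "block_sizes b n (\<nu> m n)"
      let ?B = "blown_up P (\<mu> m n) (\<nu> m n)" and ?W = "W m n \<omega>"
      let ?t = "16 * K * sqrt (real (m + n))" and ?r = "vec_space.rank a P"
      have B: "?B \<in> carrier_mat m n" by (rule blown_up_carrier[OF P sizes])
      have Wc: "?W \<in> carrier_mat m n" using W elim by (auto simp: wigner_noise_def)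
      have A: "?B + ?W \<in> carrier_mat m n" using B Wc by simp
      have Wb: "vnorm (?W *\<^sub>v x) \<le> ?t * vnorm x" if "x \<in> carrier_vec n" for x
        using k0[OF _ _ _ that] m n by simp
      have Ax: "(?B + ?W) *\<^sub>v x = ?B *\<^sub>v x + ?W *\<^sub>v x" if "x \<in> carrier_vec n" for x
        using add_mult_distrib_mat_vec[OF B Wc that] .
      have upper: "singular_values (?B + ?W) ! i \<le> singular_values ?B ! i + ?t" if "i < min m n" for i
      proof (rule singular_values_perturb[OF A B _ that])
        fix x :: "real vec" assume x: "x \<in> carrier_vec n"
        have "vnorm ((?B + ?W) *\<^sub>v x) \<le> vnorm (?B *\<^sub>v x) + vnorm (?W *\<^sub>v x)"
          unfolding Ax[OF x] using B Wc x by (intro vnorm_triangle[of _ m]) auto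
        then show "vnorm ((?B + ?W) *\<^sub>v x) \<le> vnorm (?B *\<^sub>v x) + ?t * vnorm x" using Wb[OF x] by simp
      qed
      have lower: "singular_values ?B ! i \<le> singular_values (?B + ?W) ! i + ?t" if "i < min m n" for i
      proof (rule singular_values_perturb[OF B A _ that])
        fix x :: "real vec" assume x: "x \<in> carrier_vec n"
        have Wx: "?W *\<^sub>v x \<in> carrier_vec m" and Bx: "?B *\<^sub>v x \<in> carrier_vec m" using B Wc x by auto
        \<comment> \<open>Seen from the sum, the blown up matrix is a perturbation by the negated
          noise, which has the same norm.\<close>
        have "?B *\<^sub>v x = (?B + ?W) *\<^sub>v x + - (?W *\<^sub>v x)"
          unfolding Ax[OF x] using Wx Bx by (intro eq_vecI) auto
        then have "vnorm (?B *\<^sub>v x) \<le> vnorm ((?B + ?W) *\<^sub>v x) + vnorm (- (?W *\<^sub>v x))"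
          using vnorm_triangle[of "(?B + ?W) *\<^sub>v x" m "- (?W *\<^sub>v x)"] A Wc x by simp
        moreover have "vnorm (- (?W *\<^sub>v x)) = vnorm (?W *\<^sub>v x)" using Wx by (simp add: vnorm_def)
        ultimately show "vnorm (?B *\<^sub>v x) \<le> vnorm ((?B + ?W) *\<^sub>v x) + ?t * vnorm x" using Wb[OF x] by simp
      qed
      have r: "?r \<le> min m n" "\<And>j. ?r \<le> j \<Longrightarrow> j < min m n \<Longrightarrow> singular_values ?B ! j = 0"
        using singular_values_rank(2,3)[OF B] rank[OF sizes] by simp_all
      show "\<exists>z. mset z = mset (singular_values (?B + ?W)) \<and>
        (\<forall>i<?r. \<bar>z ! i - singular_values ?B ! i\<bar> \<le> ?t) \<and>
        (\<forall>j. ?r \<le> j \<and> j < min m n \<longrightarrow> z ! j \<le> ?t)"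
      proof (intro exI[of _ "singular_values (?B + ?W)"] conjI allI impI refl)
        fix i assume "i < ?r"
        then show "\<bar>singular_values (?B + ?W) ! i - singular_values ?B ! i\<bar> \<le> ?t"
          using upper[of i] lower[of i] r(1) by (simp add: abs_le_iff)
      next
        fix j assume "?r \<le> j \<and> j < min m n"
        \<comment> \<open>Here the singular value of \<open>?B\<close> is 0, so the upper half of
          the perturbation bound is already the claim.\<close>
        then show "singular_values (?B + ?W) ! j \<le> ?t" using upper[of j] r(2)[of j] by simp
      qed
    qed
  qed
qed

end
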